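(* Suppose that each $f_i$, $i\in\mathcal{V}$, is strongly convex over $X_i$ with convexity parameter $\theta_i>0$, that $\mathbf{0}_d\in\operatorname{int}\bigcap_{i\in\mathcal{V}}X_i$, and that there is an integer $B>0$ such that for every integer $k\ge0$ the graph $(\mathcal{V},\bigcup_{t=kB}^{(k+1)B-1}\mathcal{E}^t)$ is connected. Let $(\mathbf{w}^k)_{k=0}^\infty$ and $(\mathbf{x}^k)_{k=0}^\infty$ be the dual and primal iterates generated by the Fenchel dual gradient method. If there is a finite interval $[\underline{\alpha},\bar{\alpha}]$ with $\alpha^k\in[\underline{\alpha},\bar{\alpha}]\subset(0,2/\delta)$ for all $k\ge0$, where $\delta>0$ is a constant satisfying $H_{\mathcal{G}^k}\preceq\delta\Lambda_L^{-1}$ for all $k\ge0$, then for each $k\ge0$, $$\|P_{S^\bot}(\mathbf{x}^k)\|\le\|\mathbf{x}^k-\mathbf{x}^\star\|\le\sqrt{\frac{2L\eta\tilde{M}_{\lfloor k/B\rfloor}^2(D(\mathbf{w}^0)-D^\star)}{\eta\tilde{M}_{\lfloor k/B\rfloor}^2+\rho\underline{\lambda}(D(\mathbf{w}^0)-D^\star)\lfloor k/B\rfloor}},$$ $$F(\mathbf{x}^k)-F^\star\le\|\mathbf{w}^k\|\sqrt{\frac{2L\eta\tilde{M}_{\lfloor k/B\rfloor}^2(D(\mathbf{w}^0)-D^\star)}{\eta\tilde{M}_{\lfloor k/B\rfloor}^2+\rho\underline{\lambda}(D(\mathbf{w}^0)-D^\star)\lfloor k/B\rfloor}},$$ $$F(\mathbf{x}^k)-F^\star\ge-\|\mathbf{w}^\star\|\sqrt{\frac{2L\eta\tilde{M}_{\lfloor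 k/B\rfloor}^2(D(\mathbf{w}^0)-D^\star)}{\eta\tilde{M}_{\lfloor k/B\rfloor}^2+\rho\underline{\lambda}(D(\mathbf{w}^0)-D^\star)\lfloor k/B\rfloor}},$$ where $\mathbf{w}^\star$ is any optimal solution of the dual problem (maximize $-D(\mathbf{w})$ subject to $\mathbf{w}\in S^\bot$), $L=1/\min_{i\in\mathcal{V}}\theta_i$, and the constants $\eta,\rho,\underline{\lambda},\tilde{M}_j$ are as defined in the context.
   Context: Problem. Let $n\ge2$, $d\ge1$, $\mathcal{V}=\{1,\ldots,n\}$. For each $i\in\mathcal{V}$ let $f_i:\mathbb{R}^d\to\mathbb{R}$ be a convex function and $X_i\subseteq\mathbb{R}^d$ a closed convex set. A subgradient of $f_i$ at $x$ is a vector $g\in\mathbb{R}^d$ with $f_i(y)-f_i(x)-g^T(y-x)\ge0$ for all $y\in\mathbb{R}^d$. "$f_i$ is strongly convex over $X_i$ with convexity parameter $\theta_i>0$" means $f_i(y)-f_i(x)-g^T(y-x)\ge\theta_i\|y-x\|^2/2$ for all $x,y\in X_i$ and every subgradient $g$ of $f_i$ at $x$. $\|\cdot\|$ is the Euclidean norm. For $\mathbf{x}=(x_1^T,\ldots,x_n^T)^T\in\mathbb{R}^{nd}$ (blocks $x_i\in\mathbb{R}^d$) put $F(\mathbf{x})=\sum_{i\in\mathcal{V}}f_i(x_i)$. Let $S=\{\mathbf{x}\in\mathbb{R}^{nd}:x_1=\cdots=x_n\}$ and $S^\bot=\{\mathbf{w}\in\mathbb{R}^{nd}:w_1+\cdots+w_n=\mathbf{0}_d\}$,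 its orthogonal complement; $P_{S^\bot}$ is the orthogonal projection onto $S^\bot$. $F^\star$ is the optimal value and $\mathbf{x}^\star$ the unique optimal solution of: minimize $F(\mathbf{x})$ subject to $x_i\in X_i$ for all $i\in\mathcal{V}$ and $\mathbf{x}\in S$. Fenchel dual. $d_i(w_i)=\sup_{x\in X_i}\{w_i^Tx-f_i(x)\}$ and $D(\mathbf{w})=\sum_{i\in\mathcal{V}}d_i(w_i)$ for $\mathbf{w}=(w_1^T,\ldots,w_n^T)^T$; $D^\star=\min_{\mathbf{w}\in S^\bot}D(\mathbf{w})$. Let $L_i=1/\theta_i$ and $\Lambda_L=\operatorname{diag}(L_1,\ldots,L_n)$. Network. For each $k\in\{0,1,\ldots\}$, $\mathcal{G}^k=(\mathcal{V},\mathcal{E}^k)$ is an undirected graph without self-loops, with $\mathcal{E}^k\ne\emptyset$, and $\mathcal{N}_i^k=\{j:\{i,j\}\in\mathcal{E}^k\}$. Weights $h_{ij}^k=h_{ji}^k$ are given for $\{i,j\}\in\mathcal{E}^k$, all lying in a fixed finite interval $[\underline{h},\bar{h}]\subset(0,\infty)$. The weight matrix $H_{\mathcal{G}^k}\in\mathbb{R}^{n\times n}$ has entries $[H_{\mathcal{G}^k}]_{ii}=\sum_{s\in\mathcal{N}_i^k}h_{is}^k$, $[H_{\mathcal{G}^k}]_{ij}=-h_{ij}^k$ if $\{i,j\}\in\mathcal{E}^k$, and $0$ otherwise. $M\preceq M'$ means $M'-M$ is positive semidefinite. Algorithm (Fenchel dual gradient method) with step-sizes $\alpha^k>0$: start from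 any $\mathbf{w}^0\in S^\bot$; for all $k\ge0$ and $i\in\mathcal{V}$, $x_i^k=\operatorname{arg\,max}_{x\in X_i}\{(w_i^k)^Tx-f_i(x)\}$ (unique maximizer) and $w_i^{k+1}=w_i^k-\alpha^k\sum_{j\in\mathcal{N}_i^k}h_{ij}^k(x_i^k-x_j^k)$. Write $\mathbf{w}^k=((w_1^k)^T,\ldots,(w_n^k)^T)^T$ and $\mathbf{x}^k=((x_1^k)^T,\ldots,(x_n^k)^T)^T$. Constants. For each $k\in\{0,B,2B,\ldots\}$, $\tilde{\mathcal{G}}^k=(\mathcal{V},\tilde{\mathcal{E}}^k)$ is any chosen connected spanning subgraph of $(\mathcal{V},\bigcup_{t=k}^{k+B-1}\mathcal{E}^t)$, $\varpi^k$ is its maximum degree, and $\bar{\varpi}=\sup_{t\in\{0,1,\ldots\}}\varpi^{tB}$. $L_{\tilde{\mathcal{G}}^k}$ is the graph Laplacian of $\tilde{\mathcal{G}}^k$, and $\lambda_i^{\downarrow}(\cdot)$ denotes the $i$th largest eigenvalue. Then $\underline{\lambda}=\inf_{t\in\{0,1,\ldots\}}\lambda_{n-1}^{\downarrow}(L_{\tilde{\mathcal{G}}^{tB}})\in(0,\infty)$, $\eta=3B\bar{\varpi}\bar{\alpha}^2\delta L+3/\underline{h}$, $\rho=\min\{\underline{\alpha}-\frac{\underline{\alpha}^2\delta}{2},\bar{\alpha}-\frac{\bar{\alpha}^2\delta}{2}\}>0$. $\tilde{M}_0$ is an arbitrary positive constant, and for $j\ge1$ $$\tilde{M}_j=\max_{t=0,\ldots,j-1}\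 \min_{\mathbf{w}^\star\in S^\bot:D(\mathbf{w}^\star)=D^\star}\|\mathbf{w}^{tB}-\mathbf{w}^\star\|.$$ In the degenerate case where $\mathbf{w}^0$ is dual optimal, a fraction of the form $0/0$ is read as $0$. *)

theory Defs
  imports "HOL-Analysis.Analysis" "HOL-Computational_Algebra.Computational_Algebra"
begin

(* The node set is UNIV :: 'n set, so n = CARD('n). The stacked vectors of R^(nd) have type
   real^'d^'n, whose norm and inner product are the Euclidean ones; x $ i is the block x_i. *)

section \<open>Objective, constraints and Fenchel dual\<close>

definition subgradient :: "(real^'d \<Rightarrow> real) \<Rightarrow> real^'d \<Rightarrow> real^'d \<Rightarrow> bool" where
  "subgradient f x g \<longleftrightarrow> (\<forall>y. f y - f x - g \<bullet> (y - x) \<ge> 0)"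

definition strongly_convex_over :: "(real^'d \<Rightarrow> real) \<Rightarrow> (real^'d) set \<Rightarrow> real \<Rightarrow> bool" where
  "strongly_convex_over f X \<theta> \<longleftrightarrow> (\<forall>x\<in>X. \<forall>y\<in>X. \<forall>g. subgradient f x g \<longrightarrow>
     f y - f x - g \<bullet> (y - x) \<ge> \<theta> * (norm (y - x))\<^sup>2 / 2)"

definition total_cost :: "('n::finite \<Rightarrow> real^'d \<Rightarrow> real) \<Rightarrow> real^'d^'n \<Rightarrow> real" where
  "total_cost f x = (\<Sum>i\<in>UNIV. f i (x $ i))"

definition consensus :: "(real^'d^'n) set" where
  "consensus = {x. \<forall>i j. x $ i = x $ j}"

definition consensus_perp :: "(real^'d^'n::finite) set" where
  "consensus_perp = {w. (\<Sum>i\<in>UNIV. w $ i) = 0}"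

lemma consensus_perp_eq: "consensus_perp = orthogonal_comp (consensus :: (real^'d^'n::finite) set)"
proof (intro equalityI subsetI)
  fix w :: "real^'d^'n" assume w: "w \<in> consensus_perp"
  show "w \<in> orthogonal_comp consensus"
    unfolding orthogonal_comp_def orthogonal_def
  proof (intro CollectI ballI)
    fix y :: "real^'d^'n" assume "y \<in> consensus"
    then obtain c where "\<And>i. y $ i = c" unfolding consensus_def by blast
    then have "y \<bullet> w = c \<bullet> (\<Sum>i\<in>UNIV. w $ i)" by (simp add: inner_vec_def[of y w] inner_sum_right)
    then show "y \<bullet> w = 0" using w by (simp add: consensus_perp_def)
  qed
next
  fix w :: "real^'d^'n" assume w: "w \<in> orthogonal_comp consensus"
  define s where "s = (\<Sum>i\<in>UNIV. w $ i)"
  have "(\<chi> i. s) \<in> (consensus :: (real^'d^'n) set)" by (simp add: consensus_def)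
  then have "(\<chi> i. s) \<bullet> w = 0" using w by (auto simp: orthogonal_comp_def orthogonal_def)
  moreover have "(\<chi> i. s) \<bullet> w = s \<bullet> s"
    unfolding inner_vec_def[of "\<chi> i. s" w] by (simp add: s_def flip: inner_sum_right)
  ultimately show "w \<in> consensus_perp" by (simp add: consensus_perp_def s_def)
qed

definition feasible_set :: "('n::finite \<Rightarrow> (real^'d) set) \<Rightarrow> (real^'d^'n) set" where
  "feasible_set X = {x. \<forall>i. x $ i \<in> X i} \<inter> consensus"

definition primal_value :: "('n::finite \<Rightarrow> real^'d \<Rightarrow> real) \<Rightarrow> ('n \<Rightarrow> (real^'d) set) \<Rightarrow> real" where
  "primal_value f X = (INF x\<in>feasible_set X. total_cost f x)"

definition primal_solution :: "('n::finite \<Rightarrow> real^'d \<Rightarrow> real) \<Rightarrow> ('n \<Rightarrow> (real^'d) set) \<Rightarrow> real^'d^'n" where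
  "primal_solution f X = arg_min_on (total_cost f) (feasible_set X)"

(* Under strong convexity of the f i over closed nonempty X i, the suprema below are finite, and
   0 in the interior of all X i makes D attain its infimum on consensus_perp, so the real-valued
   SUP and INF never take their arbitrary default values. *)

definition conjugate_over :: "(real^'d \<Rightarrow> real) \<Rightarrow> (real^'d) set \<Rightarrow> real^'d \<Rightarrow> real" where
  "conjugate_over f X w = (SUP x\<in>X. w \<bullet> x - f x)"

definition dual_cost :: "('n::finite \<Rightarrow> real^'d \<Rightarrow> real) \<Rightarrow> ('n \<Rightarrow> (real^'d) set) \<Rightarrow> real^'d^'n \<Rightarrow> real" where
  "dual_cost f X w = (\<Sum>i\<in>UNIV. conjugate_over (f i) (X i) (w $ i))"

definition dual_value :: "('n::finite \<Rightarrow> real^'d \<Rightarrow> real) \<Rightarrow> ('n \<Rightarrow> (real^'d) set) \<Rightarrow> real" where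
  "dual_value f X = (INF w\<in>consensus_perp. dual_cost f X w)"

definition dual_solutions :: "('n::finite \<Rightarrow> real^'d \<Rightarrow> real) \<Rightarrow> ('n \<Rightarrow> (real^'d) set) \<Rightarrow> (real^'d^'n) set" where
  "dual_solutions f X = {w \<in> consensus_perp. dual_cost f X w = dual_value f X}"


section \<open>Graphs and matrices\<close>

(* An undirected graph on the nodes is given by its set of edges {i, j}. *)

definition simple_edges :: "'n set set \<Rightarrow> bool" where
  "simple_edges E \<longleftrightarrow> (\<forall>e\<in>E. card e = 2)"

definition neighbours :: "'n set set \<Rightarrow> 'n \<Rightarrow> 'n set" where
  "neighbours E i = {j. {i, j} \<in> E}"

definition graph_connected :: "'n set set \<Rightarrow> bool" where
  "graph_connected E \<longleftrightarrow> (\<forall>i j. (i, j) \<in> {(u, v). {u, v} \<in> E}\<^sup>*)"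

definition max_degree :: "'n::finite set set \<Rightarrow> nat" where
  "max_degree E = (MAX i\<in>UNIV. card (neighbours E i))"

definition weight_matrix :: "'n::finite set set \<Rightarrow> ('n \<Rightarrow> 'n \<Rightarrow> real) \<Rightarrow> real^'n^'n" where
  "weight_matrix E h = (\<chi> i j. if i = j then (\<Sum>s\<in>neighbours E i. h i s)
                               else if {i, j} \<in> E then - h i j else 0)"

definition laplacian :: "'n::finite set set \<Rightarrow> real^'n^'n" where
  "laplacian E = weight_matrix E (\<lambda>i j. 1)"

definition diag_matrix :: "('n::finite \<Rightarrow> real) \<Rightarrow> real^'n^'n" where
  "diag_matrix a = (\<chi> i j. if i = j then a i else 0)"

definition pos_semidef :: "real^'n::finite^'n \<Rightarrow> bool" where
  "pos_semidef A \<longleftrightarrow> transpose A = A \<and> (\<forall>v. 0 \<le> v \<bullet> (A *v v))"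

definition loewner_le :: "real^'n::finite^'n \<Rightarrow> real^'n^'n \<Rightarrow> bool" (infix \<open>\<preceq>\<close> 50) where
  "M \<preceq> M' \<longleftrightarrow> pos_semidef (M' - M)"

definition charpoly :: "real^'n::finite^'n \<Rightarrow> real poly" where
  "charpoly A = det (\<chi> i j. (if i = j then [:0, 1:] else 0) - [:A $ i $ j:])"

(* Eigenvalues are counted with multiplicity; the list has CARD('n) entries when A is symmetric.
   The index k is 1-based. *)

definition nth_largest_eigenvalue :: "nat \<Rightarrow> real^'n::finite^'n \<Rightarrow> real" where
  "nth_largest_eigenvalue k A = rev (sorted_list_of_multiset (proots (charpoly A))) ! (k - 1)"


section \<open>Fenchel dual gradient method\<close>

definition fenchel_dual_gradient ::
  "('n::finite \<Rightarrow> real^'d \<Rightarrow> real) \<Rightarrow> ('n \<Rightarrow> (real^'d) set) \<Rightarrow> (nat \<Rightarrow> 'n set set) \<Rightarrow>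
   (nat \<Rightarrow> 'n \<Rightarrow> 'n \<Rightarrow> real) \<Rightarrow> (nat \<Rightarrow> real) \<Rightarrow> (nat \<Rightarrow> real^'d^'n) \<Rightarrow> (nat \<Rightarrow> real^'d^'n) \<Rightarrow> bool" where
  "fenchel_dual_gradient f X E h \<alpha> w x \<longleftrightarrow>
     w 0 \<in> consensus_perp \<and>
     (\<forall>k i. x k $ i = arg_max_on (\<lambda>u. w k $ i \<bullet> u - f i u) (X i)) \<and>
     (\<forall>k i. w (Suc k) $ i = w k $ i - \<alpha> k *\<^sub>R (\<Sum>j\<in>neighbours (E k) i. h k i j *\<^sub>R (x k $ i - x k $ j)))"

(* M0 is the arbitrary value assigned to the index 0. *)

definition max_dual_distance ::
  "('n::finite \<Rightarrow> real^'d \<Rightarrow> real) \<Rightarrow> ('n \<Rightarrow> (real^'d) set) \<Rightarrow> nat \<Rightarrow> real \<Rightarrow> (nat \<Rightarrow> real^'d^'n) \<Rightarrow> nat \<Rightarrow> real" where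
  "max_dual_distance f X B M0 w j =
     (if j = 0 then M0
      else MAX t\<in>{..<j}. INF ws\<in>dual_solutions f X. norm (w (t * B) - ws))"

end

theory Submission
  imports Defs
begin

text \<open>
  The algorithm is gradient descent on the dual cost \<open>D\<close> along directions that stay in
  \<open>consensus_perp\<close>, and every bound on the primal side is paid for by the dual gap
  \<open>D(w) - D*\<close>.

  From strong convexity of the \<open>f i\<close>, the map sending a dual vector \<open>w\<close> to the stacked maximizers
  \<open>response w\<close> is the gradient of \<open>D\<close>, it is Lipschitz blockwise with constants \<open>1 / \<theta> i\<close>, and the
  suboptimality of any competitor \<open>y\<close> in the inner maximization grows quadratically in its distance
  to \<open>response w\<close> (\<open>conjugate_quadratic_growth\<close>). Since 0 is interior to every \<open>X i\<close>, \<open>D\<close> is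
  coercive and so has a minimizer on \<open>consensus_perp\<close>; there the gradient is orthogonal to
  \<open>consensus_perp\<close>, that is, the response is a consensus point, and this one point shows at once
  that there is no duality gap and that the primal problem has a solution (\<open>strong_duality\<close>).
  Quadratic growth at the primal solution then gives
  \<open>|x - x*|^2 \<le> 2 L (D(w) - D*)\<close> (\<open>response_distance_le_dual_gap\<close>), and the two bounds on the cost
  follow from weak duality and the Cauchy-Schwarz inequality, because dual vectors of
  \<open>consensus_perp\<close> are orthogonal to \<open>x*\<close>.

  It remains to show that the dual gap decays like \<open>1 / t\<close> at the times \<open>t B\<close>. One step lowers \<open>D\<close>
  by at least \<open>\<rho>\<close> times the weighted disagreement of the current responses over the current edges
  (\<open>dual_gradient_step\<close>): with \<open>\<Lambda> = diag (1 / \<theta>)\<close>, the bound on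
  the weight matrix \<open>H\<close> gives \<open>H \<Lambda> H \<preceq> \<delta> H\<close>, so the second order term is absorbed by the first order term.
  A single graph may be disconnected, but over a period of length \<open>B\<close> every edge of the connected
  graph \<open>Et (t B)\<close> is active at least once, and the responses drift during the period by an amount that is
  itself controlled by the accumulated disagreement. Hence the disagreement over \<open>Et (t B)\<close> at the
  beginning of the period is at most \<open>\<eta>\<close> times the accumulated one
  (\<open>edge_form_le_period_sum\<close>), while it is at least \<open>lam\<close> times the squared distance of the
  responses to consensus, by the spectral gap of the Laplacian
  (\<open>laplacian_eigenvalue_le_edge_form_deviation\<close>). By convexity the dual gap is at most that
  distance times the distance of \<open>w\<close> to the dual solutions (\<open>dual_gap_le_deviation\<close>). The resulting
  recursion \<open>e - e' \<ge> c e^2\<close> has the claimed solution (\<open>quadratic_recursion_bound\<close>).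
\<close>

(* Formal power series share the symbol; here it always selects a block or a coordinate. *)
no_notation fps_nth (infixl \<open>$\<close> 75)

section \<open>Strongly convex functions and their conjugates\<close>

text \<open>
  A hyperplane separating the point \<open>(x, f x)\<close> from the strict epigraph cannot be vertical,
  because \<open>f\<close> is finite everywhere; its slope is a subgradient.
\<close>

lemma convex_on_has_subgradient:
  fixes f :: "real^'d \<Rightarrow> real"
  assumes f: "convex_on UNIV f"
  shows "\<exists>g. subgradient f x g"
proof -
  let ?T = "{(y, r). f y < r}"
  have "convex ?T"
  proof (rule convexI)
    fix p q :: "(real^'d) \<times> real" and u v :: real
    assume pq: "p \<in> ?T" "q \<in> ?T" and uv: "0 \<le> u" "0 \<le> v" "u + v = 1"
    have "f (u *\<^sub>R fst p + v *\<^sub>R fst q) \<le> u * f (fst p) + v * f (fst q)"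
      using f uv unfolding convex_on_def by auto
    also have "\<dots> < u * snd p + v * snd q"
    proof (cases "u = 0")
      case True
      then show ?thesis using pq uv by auto
    next
      case False
      then have "u * f (fst p) < u * snd p" using pq uv by auto
      moreover have "v * f (fst q) \<le> v * snd q" using pq uv by (auto intro!: mult_left_mono)
      ultimately show ?thesis by linarith
    qed
    finally show "u *\<^sub>R p + v *\<^sub>R q \<in> ?T" by (simp add: case_prod_beta)
  qed
  moreover have "(x, f x + 1) \<in> ?T" by simp
  then have "?T \<noteq> {}" by blast
  ultimately obtain n b where n0: "n \<noteq> 0" and le: "\<forall>p\<in>{(x, f x)}. n \<bullet> p \<le> b" and ge: "\<forall>p\<in>?T. n \<bullet> p \<ge> b"
    using separating_hyperplane_sets[of "{(x, f x)}" ?T] by auto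
  obtain a c where n: "n = (a, c)" by (cases n)
  have sep: "a \<bullet> x + c * f x \<le> a \<bullet> y + c * r" if "f y < r" for y r
    using le ge that by (force simp: n inner_Pair)
  have "c \<ge> 0" using sep[of x "f x + 1"] by (simp add: algebra_simps)
  \<comment> \<open>A vertical hyperplane would have to bound the linear functional a on the whole space.\<close>
  moreover have "c \<noteq> 0"
  proof
    assume c: "c = 0"
    have "a \<bullet> x \<le> a \<bullet> (x - a)" using sep[of "x - a" "f (x - a) + 1"] c by simp
    then have "a \<bullet> a \<le> 0" by (simp add: inner_diff_right)
    then have "a = 0" by (metis inner_eq_zero_iff inner_ge_zero order_antisym)
    then show False using n0 n c by (simp add: zero_prod_def)
  qed
  ultimately have c: "c > 0" by simp
  have "subgradient f x (- (a /\<^sub>R c))"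
    unfolding subgradient_def
  proof
    fix y
    have "f x - a \<bullet> (y - x) / c \<le> f y"
    proof (rule dense_ge)
      fix r assume "f y < r"
      from sep[OF this] show "f x - a \<bullet> (y - x) / c \<le> r"
        using c by (simp add: field_simps inner_diff_right)
    qed
    then show "0 \<le> f y - f x - - (a /\<^sub>R c) \<bullet> (y - x)"
      using c by (simp add: divide_inverse mult.commute)
  qed
  then show ?thesis by blast
qed

text \<open>
  Strong convexity was stated through subgradients. Applying it at the intermediate point \<open>z\<close>, with
  one subgradient towards both end points, makes the linear terms cancel and leaves the usual
  modulus of convexity.
\<close>

lemma strongly_convex_over_convex_combination:
  fixes f :: "real^'d \<Rightarrow> real"
  assumes f: "convex_on UNIV f" and X: "convex X" and sc: "strongly_convex_over f X \<theta>"
    and xy: "x \<in> X" "y \<in> X" and t: "0 \<le> t" "t \<le> 1"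
  shows "f ((1 - t) *\<^sub>R x + t *\<^sub>R y) \<le> (1 - t) * f x + t * f y - \<theta> / 2 * t * (1 - t) * (norm (y - x))\<^sup>2"
proof -
  define z where "z = (1 - t) *\<^sub>R x + t *\<^sub>R y"
  have z: "z \<in> X" using X xy t unfolding z_def convex_alt by auto
  obtain g where g: "subgradient f z g" using convex_on_has_subgradient[OF f] by blast
  have zx: "x - z = - t *\<^sub>R (y - x)" and zy: "y - z = (1 - t) *\<^sub>R (y - x)"
    by (auto simp: z_def algebra_simps)
  have 1: "f x \<ge> f z - t * (g \<bullet> (y - x)) + \<theta> * (t\<^sup>2 * (norm (y - x))\<^sup>2) / 2"
    using sc z xy(1) g unfolding strongly_convex_over_def
    by (force simp: zx power_mult_distrib)
  have 2: "f y \<ge> f z + (1 - t) * (g \<bullet> (y - x)) + \<theta> * ((1 - t)\<^sup>2 * (norm (y - x))\<^sup>2) / 2"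
    using sc z xy(2) g unfolding strongly_convex_over_def
    by (force simp: zy power_mult_distrib)
  have "(1 - t) * f x + t * f y \<ge>
      (1 - t) * (f z - t * (g \<bullet> (y - x)) + \<theta> * (t\<^sup>2 * (norm (y - x))\<^sup>2) / 2)
      + t * (f z + (1 - t) * (g \<bullet> (y - x)) + \<theta> * ((1 - t)\<^sup>2 * (norm (y - x))\<^sup>2) / 2)"
    using 1 2 t by (intro add_mono mult_left_mono) auto
  also have "(1 - t) * (f z - t * (g \<bullet> (y - x)) + \<theta> * (t\<^sup>2 * (norm (y - x))\<^sup>2) / 2)
      + t * (f z + (1 - t) * (g \<bullet> (y - x)) + \<theta> * ((1 - t)\<^sup>2 * (norm (y - x))\<^sup>2) / 2)
      = f z + \<theta> / 2 * t * (1 - t) * (norm (y - x))\<^sup>2"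
    by (simp add: field_simps power2_eq_square)
  finally show ?thesis unfolding z_def by linarith
qed

locale strongly_convex_objective =
  fixes f :: "real^'d \<Rightarrow> real" and X :: "(real^'d) set" and \<theta> :: real
  assumes convex_f: "convex_on UNIV f" and closed_X: "closed X" and convex_X: "convex X"
    and X_nonempty: "X \<noteq> {}" and theta_pos: "\<theta> > 0" and strong: "strongly_convex_over f X \<theta>"
begin

definition maximizer :: "real^'d \<Rightarrow> real^'d" where
  "maximizer u = arg_max_on (\<lambda>x. u \<bullet> x - f x) X"

text \<open>
  A subgradient at some point \<open>x0\<close> of \<open>X\<close> bounds \<open>f\<close> from below by a quadratic, so outside a ball
  around \<open>x0\<close> the objective is below its value at \<open>x0\<close>, and the supremum is that over a compact set.
\<close>

lemma maximizer_exists: "\<exists>m\<in>X. \<forall>y\<in>X. u \<bullet> y - f y \<le> u \<bullet> m - f m"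
proof -
  obtain x0 where x0: "x0 \<in> X" using X_nonempty by blast
  obtain g where g: "subgradient f x0 g" using convex_on_has_subgradient[OF convex_f] by blast
  \<comment> \<open>Beyond this radius the quadratic term outweighs the linear term of slope u - g.\<close>
  define r where "r = 2 * norm (u - g) / \<theta>"
  have r0: "r \<ge> 0" using theta_pos by (simp add: r_def)
  have "compact (X \<inter> cball x0 r)" using closed_X by (simp add: closed_Int_compact)
  moreover have "x0 \<in> X \<inter> cball x0 r" using x0 r0 by simp
  then have "X \<inter> cball x0 r \<noteq> {}" by blast
  moreover have "continuous_on (X \<inter> cball x0 r) (\<lambda>x. u \<bullet> x - f x)"
    by (intro continuous_intros continuous_on_subset[OF convex_on_continuous[OF open_UNIV convex_f]]) auto
  ultimately have "\<exists>m\<in>X \<inter> cball x0 r. \<forall>y\<in>X \<inter> cball x0 r. u \<bullet> y - f y \<le> u \<bullet> m - f m"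
    by (rule continuous_attains_sup)
  then obtain m where m: "m \<in> X \<inter> cball x0 r"
    and mmax: "\<forall>y\<in>X \<inter> cball x0 r. u \<bullet> y - f y \<le> u \<bullet> m - f m"
    by blast
  have "u \<bullet> y - f y \<le> u \<bullet> m - f m" if y: "y \<in> X" for y
  proof (cases "y \<in> cball x0 r")
    case True
    then show ?thesis using mmax y by simp
  next
    case False
    then have far: "r < norm (y - x0)" by (simp add: dist_norm norm_minus_commute)
    have "f y \<ge> f x0 + g \<bullet> (y - x0) + \<theta> * (norm (y - x0))\<^sup>2 / 2"
      using strong x0 y g unfolding strongly_convex_over_def by force
    moreover have "(u - g) \<bullet> (y - x0) \<le> norm (u - g) * norm (y - x0)"
      by (rule norm_cauchy_schwarz)
    moreover have "norm (u - g) * norm (y - x0) \<le> \<theta> * norm (y - x0) / 2 * norm (y - x0)"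
      using far theta_pos by (intro mult_right_mono) (auto simp: r_def field_simps)
    ultimately have "u \<bullet> y - f y \<le> u \<bullet> x0 - f x0"
      by (simp add: inner_diff power2_eq_square algebra_simps)
    also have "\<dots> \<le> u \<bullet> m - f m" using mmax x0 r0 by simp
    finally show ?thesis .
  qed
  then show ?thesis using m by blast
qed

lemma
  shows maximizer_mem: "maximizer u \<in> X"
    and maximizer_max: "y \<in> X \<Longrightarrow> u \<bullet> y - f y \<le> u \<bullet> maximizer u - f (maximizer u)"
proof -
  have "is_arg_max (\<lambda>x. u \<bullet> x - f x) (\<lambda>x. x \<in> X) (maximizer u)"
    unfolding maximizer_def arg_max_on_def arg_max_def
    by (rule someI_ex) (use maximizer_exists[of u] in \<open>auto simp: is_arg_max_linorder\<close>)
  then show "maximizer u \<in> X" "y \<in> X \<Longrightarrow> u \<bullet> y - f y \<le> u \<bullet> maximizer u - f (maximizer u)"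
    by (auto simp: is_arg_max_linorder)
qed

lemma conjugate_eq: "conjugate_over f X u = u \<bullet> maximizer u - f (maximizer u)"
  unfolding conjugate_over_def
  by (rule cSup_eq_maximum) (auto intro: maximizer_mem maximizer_max)

text \<open>
  The segment from the maximizer to \<open>y\<close> stays in \<open>X\<close>. Comparing the objective at a point of the
  segment with its maximum, dividing by the parameter \<open>t\<close> and letting \<open>t\<close> tend to 0 leaves the full
  quadratic term; the limit is taken over \<open>z = 1 - t\<close>. All regularity of the conjugate follows from
  this inequality.
\<close>

lemma conjugate_quadratic_growth:
  assumes y: "y \<in> X"
  shows "u \<bullet> y - f y \<le> conjugate_over f X u - \<theta> / 2 * (norm (y - maximizer u))\<^sup>2"
proof -
  define m where "m = maximizer u"
  have "z * (\<theta> / 2 * (norm (y - m))\<^sup>2) \<le> conjugate_over f X u - (u \<bullet> y - f y)" if z: "0 < z" "z < 1" for z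
  proof -
    define t where "t = 1 - z"
    have t: "0 < t" "t < 1" using z by (auto simp: t_def)
    let ?p = "(1 - t) *\<^sub>R m + t *\<^sub>R y"
    have m: "m \<in> X" by (simp add: m_def maximizer_mem)
    have "?p \<in> X" using convex_X m y t unfolding convex_alt by auto
    then have "u \<bullet> ?p - f ?p \<le> u \<bullet> m - f m" unfolding m_def by (rule maximizer_max)
    moreover have "f ?p \<le> (1 - t) * f m + t * f y - \<theta> / 2 * t * (1 - t) * (norm (y - m))\<^sup>2"
      using t by (intro strongly_convex_over_convex_combination[OF convex_f convex_X strong m y]) auto
    ultimately have "t * ((1 - t) * (\<theta> / 2 * (norm (y - m))\<^sup>2)) \<le> t * ((u \<bullet> m - f m) - (u \<bullet> y - f y))"
      by (simp add: inner_add_right algebra_simps)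
    then show ?thesis using t by (simp add: conjugate_eq m_def[symmetric] t_def)
  qed
  from field_le_mult_one_interval[OF this] show ?thesis unfolding m_def by simp
qed

text \<open>
  Quadratic growth at each of the two maximizers, with the other one as competitor, adds up to
  cocoercivity of \<open>maximizer\<close>.
\<close>

lemma maximizer_lipschitz: "norm (maximizer u - maximizer v) \<le> norm (u - v) / \<theta>"
proof -
  let ?N = "norm (maximizer u - maximizer v)"
  have "\<theta> * ?N\<^sup>2 \<le> (u - v) \<bullet> (maximizer u - maximizer v)"
    using conjugate_quadratic_growth[OF maximizer_mem[of v], of u]
      conjugate_quadratic_growth[OF maximizer_mem[of u], of v]
    by (simp add: conjugate_eq norm_minus_commute inner_diff algebra_simps)
  also have "\<dots> \<le> norm (u - v) * ?N" by (rule norm_cauchy_schwarz)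
  finally have "\<theta> * ?N * ?N \<le> norm (u - v) * ?N" by (simp add: power2_eq_square mult.assoc)
  then have "\<theta> * ?N \<le> norm (u - v)"
    by (cases "?N = 0") (simp_all add: mult_le_cancel_right)
  then show ?thesis using theta_pos by (simp add: field_simps)
qed

lemma conjugate_above_tangent: "conjugate_over f X v \<ge> conjugate_over f X u + maximizer u \<bullet> (v - u)"
  using maximizer_max[OF maximizer_mem[of u], of v]
  by (simp add: conjugate_eq inner_diff inner_commute algebra_simps)

text \<open>
  Smoothness of the conjugate with constant \<open>1 / \<theta>\<close>: the error of the linearization with slope
  \<open>maximizer u\<close> is a concave quadratic in \<open>maximizer v - maximizer u\<close>, bounded by completing the
  square.
\<close>

lemma conjugate_descent:
  "conjugate_over f X v \<le> conjugate_over f X u + maximizer u \<bullet> (v - u) + (norm (v - u))\<^sup>2 / (2 * \<theta>)"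
proof -
  let ?m = "maximizer u" and ?n = "maximizer v"
  have "conjugate_over f X v
      \<le> conjugate_over f X u + ?m \<bullet> (v - u) + ((v - u) \<bullet> (?n - ?m) - \<theta> / 2 * (norm (?n - ?m))\<^sup>2)"
    using conjugate_quadratic_growth[OF maximizer_mem[of v], of u]
    by (simp add: conjugate_eq[of v] inner_diff inner_commute algebra_simps)
  moreover have "(v - u) \<bullet> (?n - ?m) - \<theta> / 2 * (norm (?n - ?m))\<^sup>2 \<le> (norm (v - u))\<^sup>2 / (2 * \<theta>)"
  proof -
    have "0 \<le> (norm (v - u - \<theta> *\<^sub>R (?n - ?m)))\<^sup>2" by simp
    also have "\<dots> = (norm (v - u))\<^sup>2 - 2 * \<theta> * ((v - u) \<bullet> (?n - ?m)) + \<theta>\<^sup>2 * (norm (?n - ?m))\<^sup>2"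
      unfolding power2_norm_eq_inner
      by (simp add: inner_diff inner_commute power2_eq_square algebra_simps)
    finally show ?thesis using theta_pos
      by (simp add: field_simps power2_eq_square)
  qed
  ultimately show ?thesis by linarith
qed

end

section \<open>Real symmetric matrices and their characteristic polynomial\<close>

text \<open>
  First-order optimality in scalar form: it turns minimality along a line into vanishing of the
  derivative.
\<close>

lemma linear_le_quadratic_imp_zero:
  fixes a b :: real
  assumes le: "\<And>t. t * a \<le> t\<^sup>2 * b"
  shows "a = 0"
proof (rule ccontr)
  assume a: "a \<noteq> 0"
  \<comment> \<open>Small enough, and of the sign of a, for the linear term to win.\<close>
  define t where "t = a / (\<bar>b\<bar> + 1)"
  have ta: "t * (\<bar>b\<bar> + 1) = a" by (simp add: t_def)
  have "t * t * (\<bar>b\<bar> + 1) = t * a" unfolding ta[symmetric] by (rule mult.assoc)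
  also have "\<dots> \<le> t * t * b" using le[of t] by (simp add: power2_eq_square)
  finally have "t * t * (\<bar>b\<bar> + 1) \<le> t * t * b" .
  moreover have "t * t > 0" using a by (simp add: t_def zero_less_mult_iff divide_less_0_iff zero_less_divide_iff linorder_neq_iff) linarith
  ultimately show False by (simp add: mult_le_cancel_left)
qed

lemma symmetric_matrix_inner:
  fixes A :: "real^'n^'n"
  assumes "transpose A = A"
  shows "u \<bullet> (A *v v) = (A *v u) \<bullet> v"
  using assms by (metis dot_lmul_matrix vector_transpose_matrix)

text \<open>
  The quadratic form attains its maximum over the unit sphere of \<open>S\<close>. At a maximizer \<open>v\<close> with value
  \<open>c\<close> the residual \<open>A v - c v\<close> lies in \<open>S\<close>, is orthogonal to \<open>v\<close>, and is the direction of steepest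
  ascent, so it has to vanish.
\<close>

lemma symmetric_matrix_eigenvector_in_subspace:
  fixes A :: "real^'n^'n"
  assumes A: "transpose A = A" and S: "subspace S" and inv: "\<And>v. v \<in> S \<Longrightarrow> A *v v \<in> S"
    and ne: "S \<noteq> {0}"
  shows "\<exists>v\<in>S. norm v = 1 \<and> (\<exists>c. A *v v = c *\<^sub>R v)"
proof -
  let ?K = "S \<inter> sphere 0 1"
  let ?q = "\<lambda>v. v \<bullet> (A *v v)"
  obtain s where s: "s \<in> S" "s \<noteq> 0" using ne subspace_0[OF S] by blast
  then have "s /\<^sub>R norm s \<in> ?K" using S by (simp add: subspace_scale)
  then have "?K \<noteq> {}" by blast
  moreover have "compact ?K" using S by (simp add: closed_subspace closed_Int_compact)
  moreover have "continuous_on ?K ?q"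
    by (intro continuous_intros linear_continuous_on matrix_vector_mul_bounded_linear)
  ultimately have "\<exists>v\<in>?K. \<forall>u\<in>?K. ?q u \<le> ?q v"
    by (intro continuous_attains_sup)
  then obtain v where v: "v \<in> S" "norm v = 1" and vmax: "\<And>u. u \<in> S \<Longrightarrow> norm u = 1 \<Longrightarrow> ?q u \<le> ?q v"
    by auto
  define c where "c = ?q v"
  define r where "r = A *v v - c *\<^sub>R v"
  have rS: "r \<in> S" unfolding r_def using S v inv by (intro subspace_diff subspace_scale) auto
  have homog: "?q u \<le> c * (u \<bullet> u)" if u: "u \<in> S" for u
  proof (cases "u = 0")
    case False
    have "?q (u /\<^sub>R norm u) \<le> c" unfolding c_def
      by (rule vmax) (use u False S in \<open>auto simp: subspace_scale\<close>)
    then have "?q u / (norm u)\<^sup>2 \<le> c"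
      by (simp add: matrix_vector_mult_scaleR power2_eq_square divide_inverse mult_ac)
    then show ?thesis using False by (simp add: power2_norm_eq_inner divide_le_eq)
  qed simp
  have vr: "v \<bullet> r = 0"
    using v(2) by (simp add: r_def c_def inner_diff_right norm_eq_1)
  have lin: "?q (v + t *\<^sub>R r) = c + 2 * t * (r \<bullet> (A *v v)) + t\<^sup>2 * ?q r" for t
    by (simp add: c_def matrix_vector_right_distrib matrix_vector_mult_scaleR inner_add
        symmetric_matrix_inner[OF A, of v r] inner_commute power2_eq_square algebra_simps)
  have rr: "r \<bullet> (A *v v) = r \<bullet> r"
    using vr by (simp add: r_def inner_diff_right inner_diff_left inner_commute algebra_simps)
  \<comment> \<open>Moving from v in the direction of the residual r raises the quadratic form at first order.\<close>
  have key: "2 * t * (r \<bullet> r) \<le> t\<^sup>2 * (c * (r \<bullet> r) - ?q r)" for t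
  proof -
    have "?q (v + t *\<^sub>R r) \<le> c * ((v + t *\<^sub>R r) \<bullet> (v + t *\<^sub>R r))"
      by (rule homog) (use S v rS in \<open>auto intro: subspace_add subspace_scale\<close>)
    also have "(v + t *\<^sub>R r) \<bullet> (v + t *\<^sub>R r) = 1 + t\<^sup>2 * (r \<bullet> r)"
      using vr v(2) by (simp add: inner_add inner_commute norm_eq_1 power2_eq_square)
    finally show ?thesis unfolding lin rr by (simp add: algebra_simps)
  qed
  have "2 * (r \<bullet> r) = 0"
    by (rule linear_le_quadratic_imp_zero[of _ "c * (r \<bullet> r) - ?q r"]) (use key in \<open>simp add: algebra_simps\<close>)
  then have "A *v v = c *\<^sub>R v" by (simp add: r_def)
  then show ?thesis using v by blast
qed

text \<open>
  The spectral theorem relative to an invariant subspace: the complement of an eigenvector within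
  \<open>S\<close> is again invariant and has smaller dimension. The relative form is needed to keep the
  constant vector as one prescribed eigenvector of a Laplacian.
\<close>

lemma symmetric_matrix_orthonormal_eigenbasis_subspace:
  fixes A :: "real^'n^'n"
  assumes A: "transpose A = A" and S: "subspace S" and inv: "\<And>v. v \<in> S \<Longrightarrow> A *v v \<in> S"
  shows "\<exists>K. K \<subseteq> S \<and> finite K \<and> pairwise orthogonal K \<and> (\<forall>v\<in>K. norm v = 1)
           \<and> (\<forall>v\<in>K. \<exists>c. A *v v = c *\<^sub>R v) \<and> span K = S"
  using S inv
proof (induction "dim S" arbitrary: S rule: less_induct)
  case (less S)
  show ?case
  proof (cases "S = {0}")
    case True
    then show ?thesis by (intro exI[of _ "{}"]) auto
  next
    case False
    obtain v c where v: "v \<in> S" "norm v = 1" "A *v v = c *\<^sub>R v"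
      using symmetric_matrix_eigenvector_in_subspace[OF A less.prems False] by blast
    define T where "T = {y \<in> S. v \<bullet> y = 0}"
    have T: "subspace T"
      using less.prems(1) by (auto simp: T_def subspace_def inner_add_right)
    have vT: "v \<notin> T" using v by (auto simp: T_def norm_eq_1)
    have "T \<subseteq> S" by (auto simp: T_def)
    with v(1) vT have "T \<subset> S" by blast
    then have "span T \<subset> span S" using T less.prems(1) by (metis span_eq_iff)
    then have dim: "dim T < dim S" by (rule dim_psubset)
    have "A *v y \<in> T" if "y \<in> T" for y
      using that less.prems(2) v(3) by (simp add: T_def symmetric_matrix_inner[OF A])
    then obtain K where K: "K \<subseteq> T" "finite K" "pairwise orthogonal K" "\<forall>u\<in>K. norm u = 1"
        "\<forall>u\<in>K. \<exists>c. A *v u = c *\<^sub>R u" "span K = T"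
      using less.hyps[OF dim T] by blast
    have "span (insert v K) = S"
    proof
      show "span (insert v K) \<subseteq> S"
        using K(1) v less.prems(1) by (intro span_minimal) (auto simp: T_def)
      show "S \<subseteq> span (insert v K)"
      proof
        fix y assume y: "y \<in> S"
        have "y - (v \<bullet> y) *\<^sub>R v \<in> span K"
          unfolding K(6) using y v less.prems(1)
          by (auto simp: T_def inner_diff_right norm_eq_1 intro: subspace_diff subspace_scale)
        then show "y \<in> span (insert v K)" by (auto simp: span_insert)
      qed
    qed
    moreover have "pairwise orthogonal (insert v K)"
      using K(1,3) by (auto simp: pairwise_insert orthogonal_def T_def inner_commute)
    moreover have "insert v K \<subseteq> S" using K(1) v by (auto simp: T_def)
    ultimately show ?thesis using K v by (intro exI[of _ "insert v K"]) auto
  qed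
qed

text \<open>
  The matrix of constant polynomials taken from \<open>Q\<close> is still invertible, so the characteristic
  matrix can be diagonalized over the polynomial ring, where determinants are multiplicative.
\<close>

lemma charpoly_diagonalizable:
  fixes A Q :: "real^'n^'n" and a :: "'n \<Rightarrow> real"
  assumes Q: "orthogonal_matrix Q" and AQ: "\<And>j. A *v column j Q = a j *\<^sub>R column j Q"
  shows "charpoly A = (\<Prod>j\<in>UNIV. [:- a j, 1:])"
proof -
  let ?P = "\<chi> i j. [:Q $ i $ j:]" 
  let ?xA = "\<chi> i j. (if i = j then [:0, 1:] else 0) - [:A $ i $ j:]"
  let ?xD = "\<chi> i j. if i = j then [:- a j, 1:] else (0::real poly)"
  have const_sum: "(\<Sum>k\<in>K. [:g k:]) = [:\<Sum>k\<in>K. g k:]" for K and g :: "'n \<Rightarrow> real"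
    by (induction K rule: infinite_finite_induct) auto
  have orth: "(\<Sum>k\<in>UNIV. Q $ k $ i * Q $ k $ j) = (if i = j then 1 else 0)" for i j
    using Q unfolding orthogonal_matrix_def matrix_matrix_mult_def transpose_def mat_def
    by (simp add: vec_eq_iff)
  have eig: "(\<Sum>k\<in>UNIV. A $ i $ k * Q $ k $ j) = a j * Q $ i $ j" for i j
    using AQ[of j] unfolding matrix_vector_mult_def column_def by (simp add: vec_eq_iff)
  have "transpose ?P ** ?P = mat 1"
    unfolding vec_eq_iff matrix_matrix_mult_def transpose_def mat_def
    by (auto simp: const_sum orth)
  then have "det (transpose ?P) * det ?P = 1" by (metis det_mul det_I)
  then have P0: "det ?P \<noteq> 0" by auto
  have "?xA ** ?P = ?P ** ?xD"
    unfolding vec_eq_iff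
  proof (intro allI)
    fix i j
    have "(?xA ** ?P) $ i $ j = [:0, 1:] * [:Q $ i $ j:] - (\<Sum>k\<in>UNIV. [:A $ i $ k * Q $ k $ j:])"
    proof -
      have "(?xA ** ?P) $ i $ j
          = (\<Sum>k\<in>UNIV. (if i = k then [:0, 1:] * [:Q $ k $ j:] else 0) - [:A $ i $ k * Q $ k $ j:])"
        unfolding matrix_matrix_mult_def by (auto simp: algebra_simps intro!: sum.cong)
      then show ?thesis by (simp add: sum_subtractf)
    qed
    also have "\<dots> = [:Q $ i $ j:] * [:- a j, 1:]"
      by (simp add: const_sum eig)
    also have "\<dots> = (?P ** ?xD) $ i $ j"
      unfolding matrix_matrix_mult_def
      by (simp add: if_distrib[where f = "\<lambda>c. _ * c"] cong: if_cong)
    finally show "(?xA ** ?P) $ i $ j = (?P ** ?xD) $ i $ j" .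
  qed
  from arg_cong[OF this, of det] have "det ?xA * det ?P = det ?P * det ?xD" unfolding det_mul .
  then have "det ?xA = det ?xD" using P0 by (simp add: mult.commute)
  also have "det ?xD = (\<Prod>j\<in>UNIV. [:- a j, 1:])"
    by (subst det_diagonal) auto
  finally show ?thesis unfolding charpoly_def .
qed

text \<open>
  The constant vector is an eigenvector for the eigenvalue 0, the least one. An eigenbasis of its
  orthogonal complement supplies the remaining eigenvalues, counted with multiplicity as roots of
  the characteristic polynomial. The entry with index \<open>CARD('n) - 1\<close> of the decreasing list is
  therefore the least of these, and it bounds the quadratic form on the complement.
\<close>

lemma second_smallest_eigenvalue:
  fixes A :: "real^'n^'n"
  assumes A: "transpose A = A" and psd: "\<And>v. 0 \<le> v \<bullet> (A *v v)" and A1: "A *v 1 = 0"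
    and n: "CARD('n) \<ge> 2"
  defines "\<mu> \<equiv> nth_largest_eigenvalue (CARD('n) - 1) A"
  shows second_smallest_eigenvalue_nonneg: "0 \<le> \<mu>"
    and second_smallest_eigenvalue_le: "(\<Sum>i\<in>UNIV. v $ i) = 0 \<Longrightarrow> \<mu> * (norm v)\<^sup>2 \<le> v \<bullet> (A *v v)"
proof -
  let ?one = "1 :: real^'n"
  define S where "S = {v. ?one \<bullet> v = 0}"
  have one0: "?one \<noteq> 0" by (simp add: vec_eq_iff)
  have S: "subspace S" unfolding S_def by (rule subspace_hyperplane)
  have inv: "A *v v \<in> S" for v
    by (simp add: S_def symmetric_matrix_inner[OF A] A1)
  obtain K where K: "K \<subseteq> S" "finite K" "pairwise orthogonal K" "\<And>u. u \<in> K \<Longrightarrow> norm u = 1"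
      "\<And>u. u \<in> K \<Longrightarrow> \<exists>c. A *v u = c *\<^sub>R u" "span K = S"
    using symmetric_matrix_orthonormal_eigenbasis_subspace[OF A S inv] by blast
  have "independent K"
    using K(3,4) by (intro pairwise_orthogonal_independent) force+
  then have "card K = dim S" using K(6) by (metis dim_span_eq_card_independent)
  also have "dim S = CARD('n) - 1"
    unfolding S_def using dim_hyperplane[OF one0] by simp
  finally have cardK: "card K = CARD('n) - 1" .
  define q where "q = ?one /\<^sub>R norm ?one"
  have q1: "norm q = 1" using one0 by (simp add: q_def)
  have qK: "q \<bullet> u = 0" if "u \<in> K" for u using that K(1) by (auto simp: q_def S_def)
  then have q_notin: "q \<notin> K" using q1 by (metis inner_eq_zero_iff norm_zero zero_neq_one)
  have "card (insert q K) = CARD('n)" using cardK q_notin K(2) n by simp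
  then obtain b where b: "bij_betw b (UNIV :: 'n set) (insert q K)"
    using K(2) by (metis finite finite_insert finite_same_card_bij)
  define Q where "Q = (\<chi> i j. b j $ i)"
  have col: "column j Q = b j" for j by (simp add: column_def Q_def vec_eq_iff)
  have bK: "b j \<in> insert q K" for j using b by (auto simp: bij_betw_def)
  have "pairwise orthogonal (insert q K)"
    using K(3) qK by (auto simp: pairwise_insert orthogonal_def inner_commute)
  then have orth_b: "i \<noteq> j \<Longrightarrow> orthogonal (b i) (b j)" for i j
    using bK b unfolding pairwise_def bij_betw_def inj_on_def by blast
  have norm_b: "norm (b j) = 1" for j using bK[of j] q1 K(4) by auto
  have Q: "orthogonal_matrix Q"
    unfolding orthogonal_matrix_orthonormal_columns col using norm_b orth_b by blast
  obtain i0 where i0: "b i0 = q" using b unfolding bij_betw_def by (metis imageE insertI1)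
  have "\<exists>c. A *v b j = c *\<^sub>R b j" for j
  proof (cases "b j = q")
    case True
    then show ?thesis by (intro exI[of _ 0]) (simp add: q_def matrix_vector_mult_scaleR A1)
  next
    case False
    then show ?thesis using bK[of j] K(5) by blast
  qed
  then obtain a where a: "\<And>j. A *v b j = a j *\<^sub>R b j" by metis
  have a_nonneg: "0 \<le> a j" for j
    using psd[of "b j"] norm_b[of j] by (simp add: a norm_eq_1)
  have a0: "a i0 = 0"
    using a[of i0] norm_b[of i0] unfolding i0 by (auto simp: q_def matrix_vector_mult_scaleR A1)
  define M where "M = image_mset a (mset_set (UNIV - {i0}))"
  have "charpoly A = (\<Prod>j\<in>UNIV. [:- a j, 1:])"
    by (rule charpoly_diagonalizable[OF Q]) (simp add: col a)
  also have "proots \<dots> = (\<Sum>j\<in>UNIV. {#a j#})" by (subst proots_prod) auto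
  also have "\<dots> = add_mset 0 M"
  proof -
    have "(\<Sum>j\<in>UNIV. {#a j#}) = {#a i0#} + (\<Sum>j\<in>UNIV - {i0}. {#a j#})"
      by (rule sum.remove) auto
    also have "(\<Sum>j\<in>UNIV - {i0}. {#a j#}) = M"
      unfolding M_def by (simp add: sum_unfold_sum_mset)
    finally show ?thesis by (simp add: a0)
  qed
  finally have roots: "proots (charpoly A) = add_mset 0 M" .
  define xs where "xs = sorted_list_of_multiset M"
  have set_xs: "set xs = a ` (UNIV - {i0})" by (simp add: xs_def M_def)
  have len: "length xs = CARD('n) - 1"
    unfolding xs_def M_def by (metis card_Diff_singleton finite_Diff finite iso_tuple_UNIV_I mset_sorted_list_of_multiset size_image_mset size_mset size_mset_set)
  have "sorted_list_of_multiset (add_mset 0 M) = 0 # xs"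
    unfolding xs_def sorted_list_of_multiset_insert
    by (rule insort_is_Cons) (use set_xs a_nonneg in \<open>auto simp: xs_def\<close>)
  then have mu: "\<mu> = xs ! 0"
    unfolding \<mu>_def nth_largest_eigenvalue_def roots
    using len n by (simp add: nth_append rev_nth)
  have "xs \<noteq> []" using len n by auto
  then have "\<mu> \<in> set xs" unfolding mu by (simp add: nth_mem)
  then show mu_nonneg: "0 \<le> \<mu>" using set_xs a_nonneg by auto
  have "sorted xs" by (simp add: xs_def)
  then have mu_le: "\<mu> \<le> y" if "y \<in> set xs" for y
    using that unfolding mu by (metis in_set_conv_nth le0 sorted_nth_mono)
  show "\<mu> * (norm v)\<^sup>2 \<le> v \<bullet> (A *v v)" if v: "(\<Sum>i\<in>UNIV. v $ i) = 0"
  proof -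
    have "v \<in> span K" unfolding K(6) S_def using v by (simp add: inner_vec_def)
    then have expand: "(\<Sum>u\<in>K. (v \<bullet> u) *\<^sub>R u) = v"
      by (intro orthonormal_basis_expand K) 
    have eig: "(v \<bullet> u) * (\<mu> * (v \<bullet> u)) \<le> (v \<bullet> u) * (u \<bullet> (A *v v))" if u: "u \<in> K" for u
    proof -
      obtain j where j: "b j = u" using u b unfolding bij_betw_def by (metis imageE insertI2)
      then have "j \<noteq> i0" using u i0 q_notin by auto
      then have "\<mu> \<le> a j" using set_xs by (intro mu_le) auto
      then have "\<mu> * (v \<bullet> u)\<^sup>2 \<le> a j * (v \<bullet> u)\<^sup>2" by (rule mult_right_mono) simp
      moreover have "u \<bullet> (A *v v) = a j * (v \<bullet> u)"
        using a[of j] j by (simp add: symmetric_matrix_inner[OF A] inner_commute)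
      ultimately show ?thesis by (simp add: power2_eq_square algebra_simps)
    qed
    have "\<mu> * (norm v)\<^sup>2 = \<mu> * ((\<Sum>u\<in>K. (v \<bullet> u) *\<^sub>R u) \<bullet> v)"
      unfolding expand by (simp add: power2_norm_eq_inner)
    also have "\<dots> = (\<Sum>u\<in>K. (v \<bullet> u) * (\<mu> * (v \<bullet> u)))"
      unfolding inner_sum_left sum_distrib_left by (simp add: inner_commute mult_ac)
    also have "\<dots> \<le> (\<Sum>u\<in>K. (v \<bullet> u) * (u \<bullet> (A *v v)))" by (rule sum_mono) (rule eig)
    also have "\<dots> = (\<Sum>u\<in>K. (v \<bullet> u) *\<^sub>R u) \<bullet> (A *v v)"
      by (simp add: inner_sum_left)
    also have "\<dots> = v \<bullet> (A *v v)" unfolding expand ..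
    finally show ?thesis .
  qed
qed


section \<open>Quadratic forms of weighted graphs\<close>

text \<open>
  The quadratic form of the weighted Laplacian, for node values in any inner product space. The
  factor 1/2 compensates that the double sum visits each edge from both ends.
\<close>

definition edge_form :: "'n::finite set set \<Rightarrow> ('n \<Rightarrow> 'n \<Rightarrow> real) \<Rightarrow> ('n \<Rightarrow> 'a::real_inner) \<Rightarrow> real" where
  "edge_form E h u = (\<Sum>i\<in>UNIV. \<Sum>j\<in>neighbours E i. h i j * (norm (u i - u j))\<^sup>2) / 2"

text \<open>
  The weighted Laplacian applied to the node values \<open>u\<close>.
\<close>

definition edge_flow :: "'n::finite set set \<Rightarrow> ('n \<Rightarrow> 'n \<Rightarrow> real) \<Rightarrow> ('n \<Rightarrow> 'a::real_inner) \<Rightarrow> 'n \<Rightarrow> 'a" where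
  "edge_flow E h u i = (\<Sum>j\<in>neighbours E i. h i j *\<^sub>R (u i - u j))"

lemma neighbours_iff: "j \<in> neighbours E i \<longleftrightarrow> {i, j} \<in> E"
  by (simp add: neighbours_def)

text \<open>
  Summation by parts on a graph rests on the symmetry of the neighbour relation.
\<close>

lemma neighbours_sum_swap:
  fixes E :: "'n::finite set set"
  shows "(\<Sum>i\<in>UNIV. \<Sum>j\<in>neighbours E i. g i j) = (\<Sum>i\<in>UNIV. \<Sum>j\<in>neighbours E i. g j i)"
  using sum.swap_restrict[of UNIV UNIV g "\<lambda>i j. {i, j} \<in> E"]
  by (simp add: neighbours_def insert_commute)

lemma edge_flow_inner:
  fixes E :: "'n::finite set set"
  assumes "\<And>i j. {i, j} \<in> E \<Longrightarrow> h i j = h j i"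
  shows "(\<Sum>i\<in>UNIV. u i \<bullet> edge_flow E h v i)
       = (\<Sum>i\<in>UNIV. \<Sum>j\<in>neighbours E i. h i j * ((u i - u j) \<bullet> (v i - v j))) / 2"
proof -
  let ?g = "\<lambda>i j. h i j * (u i \<bullet> (v i - v j))"
  have "(\<Sum>i\<in>UNIV. u i \<bullet> edge_flow E h v i) = (\<Sum>i\<in>UNIV. \<Sum>j\<in>neighbours E i. ?g i j)"
    by (simp add: edge_flow_def inner_sum_right)
  moreover have "(\<Sum>i\<in>UNIV. \<Sum>j\<in>neighbours E i. h i j * ((u i - u j) \<bullet> (v i - v j)))
      = (\<Sum>i\<in>UNIV. \<Sum>j\<in>neighbours E i. ?g i j + ?g j i)"
  proof (intro sum.cong refl)
    fix i j assume "j \<in> neighbours E i"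
    then have "h j i = h i j" using assms[of i j] by (simp add: neighbours_iff)
    then show "h i j * ((u i - u j) \<bullet> (v i - v j)) = ?g i j + ?g j i"
      by (simp add: inner_diff algebra_simps)
  qed
  moreover have "\<dots> = (\<Sum>i\<in>UNIV. \<Sum>j\<in>neighbours E i. ?g i j) + (\<Sum>i\<in>UNIV. \<Sum>j\<in>neighbours E i. ?g i j)"
    using neighbours_sum_swap[of ?g E] by (simp add: sum.distrib)
  ultimately show ?thesis by simp
qed

lemma edge_flow_inner_self:
  fixes E :: "'n::finite set set"
  assumes "\<And>i j. {i, j} \<in> E \<Longrightarrow> h i j = h j i"
  shows "(\<Sum>i\<in>UNIV. u i \<bullet> edge_flow E h u i) = edge_form E h u"
  by (simp add: edge_flow_inner[OF assms] edge_form_def power2_norm_eq_inner)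

lemma edge_flow_sum_zero:
  fixes E :: "'n::finite set set"
  assumes "\<And>i j. {i, j} \<in> E \<Longrightarrow> h i j = h j i"
  shows "(\<Sum>i\<in>UNIV. edge_flow E h u i) = 0"
proof -
  let ?g = "\<lambda>i j. h i j *\<^sub>R (u i - u j)"
  have "(\<Sum>i\<in>UNIV. \<Sum>j\<in>neighbours E i. ?g i j) = (\<Sum>i\<in>UNIV. \<Sum>j\<in>neighbours E i. ?g j i)"
    by (rule neighbours_sum_swap)
  also have "\<dots> = (\<Sum>i\<in>UNIV. \<Sum>j\<in>neighbours E i. - ?g i j)"
  proof (intro sum.cong refl)
    fix i j assume "j \<in> neighbours E i"
    then have "h j i = h i j" using assms[of i j] by (simp add: neighbours_iff)
    then show "?g j i = - ?g i j" by (simp add: algebra_simps)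
  qed
  finally have "(\<Sum>i\<in>UNIV. edge_flow E h u i) = - (\<Sum>i\<in>UNIV. edge_flow E h u i)"
    by (simp add: edge_flow_def sum_negf)
  then have "2 *\<^sub>R (\<Sum>i\<in>UNIV. edge_flow E h u i) = 0"
    unfolding scaleR_2 by (metis add.right_inverse)
  then show ?thesis by simp
qed

lemma edge_form_nonneg:
  assumes "\<And>i j. {i, j} \<in> E \<Longrightarrow> h i j \<ge> 0"
  shows "edge_form E h u \<ge> 0"
  unfolding edge_form_def using assms by (auto intro!: sum_nonneg simp: neighbours_iff)

text \<open>
  This reduces statements about vector-valued node values to scalar ones, where the form is that of
  a matrix.
\<close>

lemma edge_form_components:
  fixes u :: "'n::finite \<Rightarrow> real^'d"
  shows "edge_form E h u = (\<Sum>c\<in>UNIV. edge_form E h (\<lambda>i. u i $ c))"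
proof -
  have "(norm z)\<^sup>2 = (\<Sum>c\<in>UNIV. (z $ c)\<^sup>2)" for z :: "real^'d"
    unfolding power2_norm_eq_inner inner_vec_def by (simp add: power2_eq_square)
  then have "edge_form E h u
      = (\<Sum>i\<in>UNIV. \<Sum>j\<in>neighbours E i. \<Sum>c\<in>UNIV. h i j * (u i $ c - u j $ c)\<^sup>2) / 2"
    by (simp add: edge_form_def sum_distrib_left)
  also have "(\<Sum>i\<in>UNIV. \<Sum>j\<in>neighbours E i. \<Sum>c\<in>UNIV. h i j * (u i $ c - u j $ c)\<^sup>2)
      = (\<Sum>i\<in>UNIV. \<Sum>c\<in>UNIV. \<Sum>j\<in>neighbours E i. h i j * (u i $ c - u j $ c)\<^sup>2)"
    by (intro sum.cong refl sum.swap)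
  also have "\<dots> = (\<Sum>c\<in>UNIV. \<Sum>i\<in>UNIV. \<Sum>j\<in>neighbours E i. h i j * (u i $ c - u j $ c)\<^sup>2)"
    by (rule sum.swap)
  finally show ?thesis by (simp add: edge_form_def sum_divide_distrib)
qed

lemma weight_matrix_mult:
  fixes E :: "'n::finite set set"
  assumes "simple_edges E"
  shows "(weight_matrix E h *v v) $ i = edge_flow E h (\<lambda>i. v $ i) i"
proof -
  have loop: "i \<notin> neighbours E i" using assms by (force simp: neighbours_iff simple_edges_def)
  have "(weight_matrix E h *v v) $ i
      = (\<Sum>j\<in>UNIV. (if j = i then (\<Sum>s\<in>neighbours E i. h i s) * v $ i else 0)
                  + (if j \<in> neighbours E i then - h i j * v $ j else 0))"
    unfolding matrix_vector_mult_def weight_matrix_def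
    using loop by (auto simp: neighbours_iff intro!: sum.cong)
  also have "\<dots> = (\<Sum>s\<in>neighbours E i. h i s) * v $ i + (\<Sum>j\<in>neighbours E i. - h i j * v $ j)"
    by (simp add: sum.distrib sum.If_cases)
  finally show ?thesis
    by (simp add: edge_flow_def sum_distrib_right right_diff_distrib sum_subtractf sum_negf)
qed

lemma weight_matrix_quadratic_form:
  fixes E :: "'n::finite set set"
  assumes "simple_edges E" "\<And>i j. {i, j} \<in> E \<Longrightarrow> h i j = h j i"
  shows "v \<bullet> (weight_matrix E h *v v) = edge_form E h (\<lambda>i. v $ i)"
proof -
  have "v \<bullet> (weight_matrix E h *v v) = (\<Sum>i\<in>UNIV. v $ i \<bullet> edge_flow E h (\<lambda>i. v $ i) i)"
    unfolding inner_vec_def by (simp add: weight_matrix_mult[OF assms(1)])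
  then show ?thesis by (simp only: edge_flow_inner_self[OF assms(2)])
qed

text \<open>
  The spectral gap (Poincare inequality) for node values in \<open>real^'d\<close> with mean zero, obtained one
  coordinate at a time.
\<close>

lemma laplacian_eigenvalue_bound:
  fixes E :: "'n::finite set set"
  assumes E: "simple_edges E" and n: "CARD('n) \<ge> 2"
  defines "\<mu> \<equiv> nth_largest_eigenvalue (CARD('n) - 1) (laplacian E)"
  shows laplacian_eigenvalue_nonneg: "0 \<le> \<mu>"
    and laplacian_eigenvalue_le_edge_form: "\<And>z :: 'n \<Rightarrow> real^'d.
      (\<Sum>i\<in>UNIV. z i) = 0 \<Longrightarrow> \<mu> * (\<Sum>i\<in>UNIV. (norm (z i))\<^sup>2) \<le> edge_form E (\<lambda>i j. 1) z"
proof -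
  let ?A = "laplacian E"
  have sym: "transpose ?A = ?A"
    by (auto simp: vec_eq_iff laplacian_def weight_matrix_def transpose_def insert_commute)
  have form: "v \<bullet> (?A *v v) = edge_form E (\<lambda>i j. 1) (\<lambda>i. v $ i)" for v
    unfolding laplacian_def by (rule weight_matrix_quadratic_form[OF E]) simp
  have psd: "0 \<le> v \<bullet> (?A *v v)" for v unfolding form by (rule edge_form_nonneg) simp
  have ker: "?A *v 1 = 0"
    unfolding vec_eq_iff laplacian_def weight_matrix_mult[OF E] by (simp add: edge_flow_def)
  show "0 \<le> \<mu>" unfolding \<mu>_def by (rule second_smallest_eigenvalue_nonneg[OF sym psd ker n])
  fix z :: "'n \<Rightarrow> real^'d" assume z: "(\<Sum>i\<in>UNIV. z i) = 0"
  have comp: "\<mu> * (\<Sum>i\<in>UNIV. (z i $ c)\<^sup>2) \<le> edge_form E (\<lambda>i j. 1) (\<lambda>i. z i $ c)" for c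
  proof -
    have "(\<Sum>i\<in>UNIV. (\<chi> i. z i $ c) $ i) = 0"
      using arg_cong[OF z, of "\<lambda>v. v $ c"] by simp
    from second_smallest_eigenvalue_le[OF sym psd ker n this]
    have "\<mu> * (norm (\<chi> i. z i $ c))\<^sup>2 \<le> edge_form E (\<lambda>i j. 1) (\<lambda>i. (\<chi> i. z i $ c) $ i)"
      unfolding form \<mu>_def .
    moreover have "(norm (\<chi> i. z i $ c))\<^sup>2 = (\<Sum>i\<in>UNIV. (z i $ c)\<^sup>2)"
      unfolding power2_norm_eq_inner inner_vec_def by (simp add: power2_eq_square)
    ultimately show ?thesis by simp
  qed
  have "(\<Sum>i\<in>UNIV. (norm (z i))\<^sup>2) = (\<Sum>c\<in>UNIV. \<Sum>i\<in>UNIV. (z i $ c)\<^sup>2)"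
    unfolding power2_norm_eq_inner inner_vec_def
    by (subst sum.swap) (simp add: power2_eq_square)
  then have "\<mu> * (\<Sum>i\<in>UNIV. (norm (z i))\<^sup>2) = (\<Sum>c\<in>UNIV. \<mu> * (\<Sum>i\<in>UNIV. (z i $ c)\<^sup>2))"
    by (simp add: sum_distrib_left)
  also have "\<dots> \<le> (\<Sum>c\<in>UNIV. edge_form E (\<lambda>i j. 1) (\<lambda>i. z i $ c))"
    by (rule sum_mono) (rule comp)
  also have "\<dots> = edge_form E (\<lambda>i j. 1) z" by (simp only: edge_form_components[of _ _ z])
  finally show "\<mu> * (\<Sum>i\<in>UNIV. (norm (z i))\<^sup>2) \<le> edge_form E (\<lambda>i j. 1) z" .
qed

text \<open>
  The matrix inequality assumed in the convergence theorem, read as an inequality between quadratic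
  forms of vector-valued node values.
\<close>

lemma loewner_le_diag_edge_form:
  fixes u :: "'n::finite \<Rightarrow> real^'d"
  assumes E: "simple_edges E" and h: "\<And>i j. {i, j} \<in> E \<Longrightarrow> h i j = h j i"
    and pos: "\<And>i. \<theta> i > 0"
    and le: "weight_matrix E h \<preceq> \<delta> *\<^sub>R matrix_inv (diag_matrix (\<lambda>i. 1 / \<theta> i))"
  shows "edge_form E h u \<le> \<delta> * (\<Sum>i\<in>UNIV. \<theta> i * (norm (u i))\<^sup>2)"
proof -
  have mult: "diag_matrix a ** diag_matrix b = diag_matrix (\<lambda>i. a i * b i)" for a b :: "'n \<Rightarrow> real"
    unfolding vec_eq_iff diag_matrix_def matrix_matrix_mult_def
    by (auto simp: if_distrib[where f = "\<lambda>c. c * _"] cong: if_cong)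
  have one: "diag_matrix (\<lambda>i. 1) = (mat 1 :: real^'n^'n)"
    by (simp add: diag_matrix_def mat_def)
  have cancel: "1 / \<theta> i * \<theta> i = 1" "\<theta> i * (1 / \<theta> i) = 1" for i
    using pos[of i] by auto
  let ?D = "diag_matrix (\<lambda>i. 1 / \<theta> i)"
  have inv: "?D ** diag_matrix \<theta> = mat 1" "diag_matrix \<theta> ** ?D = mat 1"
    by (simp_all only: mult one cancel)
  have "?D ** matrix_inv ?D = mat 1 \<and> matrix_inv ?D ** ?D = mat 1"
    unfolding matrix_inv_def by (rule someI[of _ "diag_matrix \<theta>"]) (simp add: inv)
  then have "matrix_inv ?D ** (?D ** diag_matrix \<theta>) = diag_matrix \<theta>"
    by (simp add: matrix_mul_assoc)
  then have "matrix_inv ?D = diag_matrix \<theta>" by (simp add: inv)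
  then have psd: "0 \<le> v \<bullet> ((\<delta> *\<^sub>R diag_matrix \<theta> - weight_matrix E h) *v v)" for v
    using le by (simp add: loewner_le_def pos_semidef_def)
  have diag: "v \<bullet> (diag_matrix \<theta> *v v) = (\<Sum>i\<in>UNIV. \<theta> i * (v $ i)\<^sup>2)" for v
  proof -
    have "(diag_matrix \<theta> *v v) $ i = \<theta> i * v $ i" for i
      unfolding matrix_vector_mult_def diag_matrix_def
      by (simp add: if_distrib[where f = "\<lambda>c. c * _"] cong: if_cong)
    then show ?thesis unfolding inner_vec_def by (simp add: power2_eq_square mult_ac)
  qed
  have scalar: "edge_form E h (\<lambda>i. v $ i) \<le> \<delta> * (\<Sum>i\<in>UNIV. \<theta> i * (v $ i)\<^sup>2)" for v
    using psd[of v]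
    by (simp add: matrix_vector_mult_diff_rdistrib scaleR_matrix_vector_assoc[symmetric] inner_diff_right diag
        weight_matrix_quadratic_form[OF E h])
  have "edge_form E h u = (\<Sum>c\<in>UNIV. edge_form E h (\<lambda>i. u i $ c))" by (rule edge_form_components)
  also have "\<dots> \<le> (\<Sum>c\<in>UNIV. \<delta> * (\<Sum>i\<in>UNIV. \<theta> i * (u i $ c)\<^sup>2))"
    using scalar[of "\<chi> i. u i $ _"] by (intro sum_mono) simp
  also have "\<dots> = \<delta> * (\<Sum>i\<in>UNIV. \<Sum>c\<in>UNIV. \<theta> i * (u i $ c)\<^sup>2)"
    by (subst sum.swap) (simp add: sum_distrib_left)
  also have "\<dots> = \<delta> * (\<Sum>i\<in>UNIV. \<theta> i * (norm (u i))\<^sup>2)"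
    unfolding power2_norm_eq_inner inner_vec_def by (simp add: power2_eq_square sum_distrib_left)
  finally show ?thesis .
qed

text \<open>
  With \<open>H\<close> the weight matrix and \<open>\<Lambda> = diag (1 / \<theta>)\<close>, this is \<open>H \<Lambda> H \<preceq> \<delta> H\<close>, a consequence of
  \<open>H \<preceq> \<delta> \<Lambda>\<^sup>-\<^sup>1\<close>: the form of \<open>H\<close> is nonnegative at \<open>u - \<Lambda> H u / \<delta>\<close>.
\<close>

lemma edge_flow_weighted_norm_le:
  fixes u :: "'n::finite \<Rightarrow> real^'d"
  assumes h: "\<And>i j. {i, j} \<in> E \<Longrightarrow> h i j = h j i" and h_nonneg: "\<And>i j. {i, j} \<in> E \<Longrightarrow> h i j \<ge> 0"
    and pos: "\<And>i. \<theta> i > 0" and \<delta>: "\<delta> > 0"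
    and le: "\<And>u :: 'n \<Rightarrow> real^'d. edge_form E h u \<le> \<delta> * (\<Sum>i\<in>UNIV. \<theta> i * (norm (u i))\<^sup>2)"
  shows "(\<Sum>i\<in>UNIV. (norm (edge_flow E h u i))\<^sup>2 / \<theta> i) \<le> \<delta> * edge_form E h u"
proof -
  define y where "y i = edge_flow E h u i /\<^sub>R \<theta> i" for i
  define s where "s = (\<Sum>i\<in>UNIV. (norm (edge_flow E h u i))\<^sup>2 / \<theta> i)"
  have cross: "(\<Sum>i\<in>UNIV. y i \<bullet> edge_flow E h u i) = s"
    by (simp add: y_def s_def power2_norm_eq_inner divide_inverse mult.commute)
  have "(\<Sum>i\<in>UNIV. \<theta> i * (norm (y i))\<^sup>2) = s"
    unfolding y_def s_def using pos
    by (intro sum.cong refl) (simp add: power_mult_distrib power2_eq_square field_simps less_imp_le abs_of_pos)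
  with le[of y] have form_y: "edge_form E h y \<le> \<delta> * s" by simp
  have "edge_form E h (\<lambda>i. u i - c *\<^sub>R y i)
      = edge_form E h u - 2 * c * s + c\<^sup>2 * edge_form E h y" for c
  proof -
    have "(norm ((u i - c *\<^sub>R y i) - (u j - c *\<^sub>R y j)))\<^sup>2
        = (norm (u i - u j))\<^sup>2 - 2 * c * ((y i - y j) \<bullet> (u i - u j)) + c\<^sup>2 * (norm (y i - y j))\<^sup>2" for i j
    proof -
      have split: "(u i - c *\<^sub>R y i) - (u j - c *\<^sub>R y j) = (u i - u j) - c *\<^sub>R (y i - y j)"
        by (simp add: algebra_simps)
      have "(norm (p - c *\<^sub>R r))\<^sup>2 = (norm p)\<^sup>2 - 2 * c * (r \<bullet> p) + c\<^sup>2 * (norm r)\<^sup>2" for p r :: "real^'d"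
        unfolding power2_norm_eq_inner
        by (simp add: inner_diff inner_commute power2_eq_square algebra_simps)
      then show ?thesis unfolding split .
    qed
    then have "h i j * (norm ((u i - c *\<^sub>R y i) - (u j - c *\<^sub>R y j)))\<^sup>2
        = h i j * (norm (u i - u j))\<^sup>2 - 2 * c * (h i j * ((y i - y j) \<bullet> (u i - u j)))
          + c\<^sup>2 * (h i j * (norm (y i - y j))\<^sup>2)" for i j
      by (simp only:) (simp add: distrib_left right_diff_distrib mult_ac)
    then have "edge_form E h (\<lambda>i. u i - c *\<^sub>R y i) = (\<Sum>i\<in>UNIV. \<Sum>j\<in>neighbours E i.
          h i j * (norm (u i - u j))\<^sup>2 - 2 * c * (h i j * ((y i - y j) \<bullet> (u i - u j)))
          + c\<^sup>2 * (h i j * (norm (y i - y j))\<^sup>2)) / 2"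
      by (simp only: edge_form_def)
    also have "\<dots> = ((\<Sum>i\<in>UNIV. \<Sum>j\<in>neighbours E i. h i j * (norm (u i - u j))\<^sup>2)
        - 2 * c * (\<Sum>i\<in>UNIV. \<Sum>j\<in>neighbours E i. h i j * ((y i - y j) \<bullet> (u i - u j)))
        + c\<^sup>2 * (\<Sum>i\<in>UNIV. \<Sum>j\<in>neighbours E i. h i j * (norm (y i - y j))\<^sup>2)) / 2"
      by (simp only: sum.distrib sum_subtractf sum_distrib_left)
    also have "(\<Sum>i\<in>UNIV. \<Sum>j\<in>neighbours E i. h i j * ((y i - y j) \<bullet> (u i - u j))) = 2 * s"
      using cross edge_flow_inner[OF h, where u = y and v = u] by simp
    finally show ?thesis by (simp only: edge_form_def) (simp add: field_simps)
  qed
  \<comment> \<open>The step 1/delta minimizes the upper bound -2 c s + c^2 delta s over c.\<close>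
  from this[of "1 / \<delta>"] edge_form_nonneg[of E h "\<lambda>i. u i - (1 / \<delta>) *\<^sub>R y i", OF h_nonneg]
  have "0 \<le> edge_form E h u - 2 * (1 / \<delta>) * s + (1 / \<delta>)\<^sup>2 * edge_form E h y"
    by (simp only:)
  also have "\<dots> \<le> edge_form E h u - 2 * (1 / \<delta>) * s + (1 / \<delta>)\<^sup>2 * (\<delta> * s)"
    using form_y by (intro add_left_mono mult_left_mono) auto
  also have "\<dots> = edge_form E h u - s / \<delta>"
    using \<delta> by (simp add: field_simps power2_eq_square)
  finally show ?thesis unfolding s_def[symmetric] using \<delta> by (simp add: field_simps)
qed

section \<open>Consensus vectors and their orthogonal complement\<close>

lemma subspace_consensus: "subspace (consensus :: (real^'d^'n) set)"
  by (auto simp: subspace_def consensus_def) metis+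

lemma subspace_consensus_perp [simp]: "subspace (consensus_perp :: (real^'d^'n::finite) set)"
  unfolding consensus_perp_eq by (rule subspace_orthogonal_comp)

lemma consensus_inner_perp:
  fixes y w :: "real^'d^'n::finite"
  assumes "y \<in> consensus" "w \<in> consensus_perp"
  shows "w \<bullet> y = 0"
  using assms unfolding consensus_perp_eq orthogonal_comp_def orthogonal_def
  by (auto simp: inner_commute)

lemma consensus_eq_perp_perp: "consensus = orthogonal_comp (consensus_perp :: (real^'d^'n::finite) set)"
  unfolding consensus_perp_eq by (rule orthogonal_comp_self[OF subspace_consensus, symmetric])

text \<open>
  Projections are nonexpansive, and the projection onto the complement of consensus annihilates
  \<open>y\<close>.
\<close>

lemma norm_closest_point_consensus_perp_le:
  fixes x y :: "real^'d^'n::finite"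
  assumes y: "y \<in> consensus"
  shows "norm (closest_point consensus_perp x) \<le> norm (x - y)"
proof -
  let ?P = "consensus_perp :: (real^'d^'n) set"
  have P: "convex ?P" "closed ?P" "0 \<in> ?P"
    by (simp_all add: subspace_imp_convex closed_subspace subspace_0)
  have "0 = closest_point ?P y"
  proof (rule closest_point_unique[OF P], intro ballI)
    fix w :: "real^'d^'n" assume "w \<in> ?P"
    then have "(norm (y - w))\<^sup>2 = (norm y)\<^sup>2 + (norm w)\<^sup>2"
      using consensus_inner_perp[OF y, of w]
      by (simp add: power2_norm_eq_inner inner_diff inner_commute)
    then have "(norm y)\<^sup>2 \<le> (norm (y - w))\<^sup>2" by simp
    then show "dist y 0 \<le> dist y w" by (simp add: dist_norm)
  qed
  then show ?thesis
    using closest_point_lipschitz[of ?P x y] P by (auto simp: dist_norm)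
qed

text \<open>
  The projection onto \<open>consensus_perp\<close> in coordinates.
\<close>

definition mean_deviation :: "real^'d^'n::finite \<Rightarrow> real^'d^'n" where
  "mean_deviation x = (\<chi> i. x $ i - (\<Sum>j\<in>UNIV. x $ j) /\<^sub>R real CARD('n))"

lemma mean_deviation_perp:
  fixes x :: "real^'d^'n::finite"
  shows "mean_deviation x \<in> consensus_perp"
  by (simp add: consensus_perp_def mean_deviation_def sum_subtractf sum_constant_scaleR del: sum_constant)

lemma inner_mean_deviation:
  assumes "w \<in> consensus_perp"
  shows "mean_deviation x \<bullet> w = x \<bullet> w"
proof -
  have "x - mean_deviation x \<in> consensus" by (simp add: consensus_def mean_deviation_def)
  from consensus_inner_perp[OF this assms] show ?thesis
    by (simp add: inner_diff_right inner_commute)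
qed

text \<open>
  Only differences of node values enter the form, so the spectral gap for mean-zero values applies
  after subtracting the mean.
\<close>

lemma laplacian_eigenvalue_le_edge_form_deviation:
  fixes x :: "real^'d^'n::finite"
  assumes "simple_edges E" "CARD('n) \<ge> 2"
  shows "nth_largest_eigenvalue (CARD('n) - 1) (laplacian E) * (norm (mean_deviation x))\<^sup>2
    \<le> edge_form E (\<lambda>i j. 1) (\<lambda>i. x $ i)"
proof -
  have "(\<Sum>i\<in>UNIV. mean_deviation x $ i) = 0"
    using mean_deviation_perp by (simp add: consensus_perp_def)
  from laplacian_eigenvalue_le_edge_form[OF assms this]
  have "nth_largest_eigenvalue (CARD('n) - 1) (laplacian E) * (\<Sum>i\<in>UNIV. (norm (mean_deviation x $ i))\<^sup>2)
    \<le> edge_form E (\<lambda>i j. 1) (\<lambda>i. mean_deviation x $ i)" .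
  moreover have "(\<Sum>i\<in>UNIV. (norm (mean_deviation x $ i))\<^sup>2) = (norm (mean_deviation x))\<^sup>2"
    unfolding power2_norm_eq_inner inner_vec_def[of "mean_deviation x"] ..
  moreover have "edge_form E (\<lambda>i j. 1) (\<lambda>i. mean_deviation x $ i) = edge_form E (\<lambda>i j. 1) (\<lambda>i. x $ i)"
    by (simp add: edge_form_def mean_deviation_def)
  ultimately show ?thesis by simp
qed


section \<open>Duality for consensus optimization\<close>

locale consensus_problem =
  fixes f :: "'n::finite \<Rightarrow> real^'d \<Rightarrow> real" and X :: "'n \<Rightarrow> (real^'d) set" and \<theta> :: "'n \<Rightarrow> real"
  assumes objective: "\<And>i. strongly_convex_objective (f i) (X i) (\<theta> i)"
    and zero_interior: "0 \<in> interior (\<Inter>i. X i)"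
begin

text \<open>
  The gradient of the dual cost.
\<close>

definition response :: "real^'d^'n \<Rightarrow> real^'d^'n" where
  "response w = (\<chi> i. arg_max_on (\<lambda>u. w $ i \<bullet> u - f i u) (X i))"

lemma response_component: "response w $ i = strongly_convex_objective.maximizer (f i) (X i) (w $ i)"
  by (simp add: response_def strongly_convex_objective.maximizer_def[OF objective])

lemma theta_pos: "\<theta> i > 0"
  using objective by (rule strongly_convex_objective.theta_pos)

lemma response_mem: "response w $ i \<in> X i"
  unfolding response_component by (rule strongly_convex_objective.maximizer_mem[OF objective])

lemma response_lipschitz: "norm (response u $ i - response v $ i) \<le> norm (u $ i - v $ i) / \<theta> i"
  unfolding response_component by (rule strongly_convex_objective.maximizer_lipschitz[OF objective])

lemma dual_cost_eq: "dual_cost f X w = w \<bullet> response w - total_cost f (response w)"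
  unfolding dual_cost_def total_cost_def inner_vec_def[of w]
  by (simp add: strongly_convex_objective.conjugate_eq[OF objective] response_component sum_subtractf)

lemma dual_quadratic_growth:
  assumes "\<And>i. y $ i \<in> X i"
  shows "w \<bullet> y - total_cost f y
    \<le> dual_cost f X w - (\<Sum>i\<in>UNIV. \<theta> i / 2 * (norm (y $ i - response w $ i))\<^sup>2)"
proof -
  have "(\<Sum>i\<in>UNIV. w $ i \<bullet> y $ i - f i (y $ i))
      \<le> (\<Sum>i\<in>UNIV. conjugate_over (f i) (X i) (w $ i) - \<theta> i / 2 * (norm (y $ i - response w $ i))\<^sup>2)"
    unfolding response_component
    by (intro sum_mono strongly_convex_objective.conjugate_quadratic_growth[OF objective] assms)
  then show ?thesis
    unfolding dual_cost_def total_cost_def inner_vec_def[of w] by (simp add: sum_subtractf)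
qed

lemma dual_weak_duality:
  assumes "\<And>i. y $ i \<in> X i"
  shows "w \<bullet> y - total_cost f y \<le> dual_cost f X w"
proof -
  have "0 \<le> (\<Sum>i\<in>UNIV. \<theta> i / 2 * (norm (y $ i - response w $ i))\<^sup>2)"
    using theta_pos by (intro sum_nonneg) (simp add: less_imp_le)
  then show ?thesis using dual_quadratic_growth[where y = y and w = w] assms by force
qed

lemma dual_above_tangent: "dual_cost f X v \<ge> dual_cost f X u + response u \<bullet> (v - u)"
proof -
  have "(\<Sum>i\<in>UNIV. conjugate_over (f i) (X i) (u $ i) + response u $ i \<bullet> (v $ i - u $ i))
      \<le> (\<Sum>i\<in>UNIV. conjugate_over (f i) (X i) (v $ i))"
    unfolding response_component
    by (intro sum_mono strongly_convex_objective.conjugate_above_tangent[OF objective])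
  then show ?thesis unfolding dual_cost_def inner_vec_def[of "response u"] by (simp add: sum.distrib)
qed

lemma dual_descent:
  "dual_cost f X v \<le> dual_cost f X u + response u \<bullet> (v - u)
     + (\<Sum>i\<in>UNIV. (norm (v $ i - u $ i))\<^sup>2 / (2 * \<theta> i))"
proof -
  have "(\<Sum>i\<in>UNIV. conjugate_over (f i) (X i) (v $ i))
      \<le> (\<Sum>i\<in>UNIV. conjugate_over (f i) (X i) (u $ i) + response u $ i \<bullet> (v $ i - u $ i)
            + (norm (v $ i - u $ i))\<^sup>2 / (2 * \<theta> i))"
    unfolding response_component
    by (intro sum_mono strongly_convex_objective.conjugate_descent[OF objective])
  then show ?thesis unfolding dual_cost_def inner_vec_def[of "response u"] by (simp add: sum.distrib)
qed

text \<open>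
  The tangent bound below and the descent bound above enclose the increments of the dual cost.
\<close>

lemma dual_continuous: "continuous_on S (dual_cost f X)"
proof -
  have "isCont (dual_cost f X) u" for u
  proof -
    define C where "C = (\<Sum>i\<in>UNIV. 1 / (2 * \<theta> i))"
    have bound: "\<bar>dual_cost f X v - dual_cost f X u\<bar> \<le> norm (response u) * norm (v - u) + C * (norm (v - u))\<^sup>2" for v
    proof -
      have "(\<Sum>i\<in>UNIV. (norm (v $ i - u $ i))\<^sup>2 / (2 * \<theta> i)) \<le> (\<Sum>i\<in>UNIV. (norm (v - u))\<^sup>2 / (2 * \<theta> i))"
        using theta_pos by (intro sum_mono divide_right_mono power_mono)
          (auto simp: less_imp_le simp flip: vector_minus_component intro: Finite_Cartesian_Product.norm_nth_le)
      also have "\<dots> = C * (norm (v - u))\<^sup>2" by (simp add: C_def sum_distrib_right)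
      finally have "(\<Sum>i\<in>UNIV. (norm (v $ i - u $ i))\<^sup>2 / (2 * \<theta> i)) \<le> C * (norm (v - u))\<^sup>2" .
      moreover have "0 \<le> C * (norm (v - u))\<^sup>2"
        unfolding C_def using theta_pos by (intro mult_nonneg_nonneg sum_nonneg) (auto simp: less_imp_le)
      moreover have "\<bar>response u \<bullet> (v - u)\<bar> \<le> norm (response u) * norm (v - u)"
        by (rule Cauchy_Schwarz_ineq2)
      ultimately show ?thesis
        using dual_descent[of v u] dual_above_tangent[of u v] by linarith
    qed
    have "((\<lambda>v. norm (response u) * norm (v - u) + C * (norm (v - u))\<^sup>2)
        \<longlongrightarrow> norm (response u) * norm (u - u) + C * (norm (u - u))\<^sup>2) (at u)"
      by (intro tendsto_intros)
    then have lim: "((\<lambda>v. norm (response u) * norm (v - u) + C * (norm (v - u))\<^sup>2) \<longlongrightarrow> 0) (at u)"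
      by simp
    have "((\<lambda>v. dual_cost f X v - dual_cost f X u) \<longlongrightarrow> 0) (at u)"
      by (rule Lim_null_comparison[OF always_eventually lim]) (simp add: bound)
    then show ?thesis unfolding isCont_def by (simp add: LIM_zero_iff)
  qed
  then show ?thesis by (simp add: continuous_at_imp_continuous_on)
qed

text \<open>
  Let \<open>e\<close> be the radius of a ball contained in every \<open>X i\<close>. Weak duality at the point whose blocks
  are \<open>e sgn (w $ i)\<close>, aligned with \<open>w\<close>, yields linear growth, since the \<open>f i\<close> are bounded on the
  ball.
\<close>

lemma dual_coercive: "\<exists>e c. e > 0 \<and> (\<forall>w. e * norm w - c \<le> dual_cost f X w)"
proof -
  obtain e where e: "e > 0" "cball 0 e \<subseteq> (\<Inter>i. X i)"
    using zero_interior by (auto simp: mem_interior_cball)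
  have "\<exists>b. \<forall>y\<in>cball 0 e. f i y \<le> b" for i
  proof -
    have "continuous_on (cball 0 e) (f i)"
      by (rule continuous_on_subset[OF convex_on_continuous[OF open_UNIV strongly_convex_objective.convex_f[OF objective]]]) simp
    then have "\<exists>z\<in>cball 0 e. \<forall>y\<in>cball 0 e. f i y \<le> f i z"
      using e(1) by (intro continuous_attains_sup) auto
    then show ?thesis by blast
  qed
  then obtain b where b: "\<And>i y. y \<in> cball 0 e \<Longrightarrow> f i y \<le> b i" by metis
  have "e * norm w - (\<Sum>i\<in>UNIV. b i) \<le> dual_cost f X w" for w
  proof -
    define y where "y = (\<chi> i. e *\<^sub>R sgn (w $ i))"
    have y: "y $ i \<in> cball 0 e" for i using e(1) by (simp add: y_def norm_sgn)
    have "w $ i \<bullet> y $ i = e * norm (w $ i)" for i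
      by (simp add: y_def sgn_div_norm power2_norm_eq_inner[symmetric] power2_eq_square field_simps)
    then have "w \<bullet> y = e * (\<Sum>i\<in>UNIV. norm (w $ i))"
      unfolding inner_vec_def by (simp add: sum_distrib_left)
    moreover have "norm w \<le> (\<Sum>i\<in>UNIV. norm (w $ i))"
      unfolding norm_vec_def by (rule L2_set_le_sum) simp
    then have "e * norm w \<le> e * (\<Sum>i\<in>UNIV. norm (w $ i))" using e(1) by simp
    moreover have "total_cost f y \<le> (\<Sum>i\<in>UNIV. b i)"
      unfolding total_cost_def by (intro sum_mono b y)
    moreover have "w \<bullet> y - total_cost f y \<le> dual_cost f X w"
      by (rule dual_weak_duality) (use y e(2) in blast)
    ultimately show ?thesis by linarith
  qed
  then show ?thesis using e(1) by blast
qed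

lemma dual_minimizer_exists: "\<exists>ws\<in>consensus_perp. \<forall>v\<in>consensus_perp. dual_cost f X ws \<le> dual_cost f X v"
proof -
  let ?P = "consensus_perp :: (real^'d^'n) set"
  obtain e c where e: "e > 0" and coercive: "\<And>w. e * norm w - c \<le> dual_cost f X w"
    using dual_coercive by blast
  define r where "r = (dual_cost f X 0 + c) / e"
  have r0: "0 \<le> r" using coercive[of 0] e by (simp add: r_def)
  have "compact (?P \<inter> cball 0 r)"
    by (simp add: closed_subspace closed_Int_compact)
  moreover have zero: "0 \<in> ?P \<inter> cball 0 r"
    using r0 by (simp add: subspace_0)
  then have "?P \<inter> cball 0 r \<noteq> {}" by blast
  ultimately have "\<exists>ws\<in>?P \<inter> cball 0 r. \<forall>v\<in>?P \<inter> cball 0 r. dual_cost f X ws \<le> dual_cost f X v"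
    using dual_continuous by (rule continuous_attains_inf)
  then obtain ws where ws: "ws \<in> ?P" and min: "\<And>v. v \<in> ?P \<inter> cball 0 r \<Longrightarrow> dual_cost f X ws \<le> dual_cost f X v"
    by blast
  have "dual_cost f X ws \<le> dual_cost f X v" if v: "v \<in> ?P" for v
  proof (cases "v \<in> cball 0 r")
    case False
    then have "e * r < e * norm v" using e by simp
    then have "dual_cost f X 0 < dual_cost f X v" using coercive[of v] e by (simp add: r_def)
    then show ?thesis using min[OF zero] by linarith
  qed (use min v in blast)
  then show ?thesis using ws by blast
qed

text \<open>
  First-order optimality: the gradient \<open>response ws\<close> is orthogonal to \<open>consensus_perp\<close>.
\<close>

lemma response_at_dual_minimizer:
  assumes ws: "ws \<in> consensus_perp" and min: "\<And>v. v \<in> consensus_perp \<Longrightarrow> dual_cost f X ws \<le> dual_cost f X v"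
  shows "response ws \<in> consensus"
proof -
  have "response ws \<bullet> v = 0" if v: "v \<in> consensus_perp" for v
  proof -
    define C where "C = (\<Sum>i\<in>UNIV. (norm (v $ i))\<^sup>2 / (2 * \<theta> i))"
    have "t * (response ws \<bullet> v) \<le> t\<^sup>2 * C" for t
    proof -
      have "ws - t *\<^sub>R v \<in> consensus_perp"
        using ws v by (intro subspace_diff subspace_scale) auto
      from order_trans[OF min[OF this] dual_descent[of _ ws]] show ?thesis
        by (simp add: C_def sum_distrib_left power_mult_distrib)
    qed
    then show ?thesis by (rule linear_le_quadratic_imp_zero)
  qed
  then show ?thesis unfolding consensus_eq_perp_perp orthogonal_comp_def orthogonal_def
    by (auto simp: inner_commute)
qed

lemma dual_cost_ge_neg_total_cost:
  assumes "y \<in> feasible_set X" "w \<in> consensus_perp"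
  shows "- total_cost f y \<le> dual_cost f X w"
  using dual_weak_duality[of y w] consensus_inner_perp[of y w] assms by (auto simp: feasible_set_def)

text \<open>
  The response to a dual minimizer is feasible and attains the weak duality bound, so it solves the
  primal problem. In particular neither the infima nor the choice in \<open>arg_min_on\<close> take default
  values.
\<close>

lemma strong_duality:
  shows dual_solutions_nonempty: "dual_solutions f X \<noteq> {}"
    and dual_value_le: "w \<in> consensus_perp \<Longrightarrow> dual_value f X \<le> dual_cost f X w"
    and primal_value_eq: "primal_value f X = - dual_value f X"
    and primal_solution_feasible: "primal_solution f X \<in> feasible_set X"
    and total_cost_primal_solution: "total_cost f (primal_solution f X) = primal_value f X"
proof -
  obtain ws where ws: "ws \<in> consensus_perp" and min: "\<And>v. v \<in> consensus_perp \<Longrightarrow> dual_cost f X ws \<le> dual_cost f X v"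
    using dual_minimizer_exists by blast
  have val: "dual_value f X = dual_cost f X ws"
    unfolding dual_value_def by (rule cInf_eq_minimum) (use ws min in auto)
  show "dual_solutions f X \<noteq> {}" unfolding dual_solutions_def using ws val by auto
  show "w \<in> consensus_perp \<Longrightarrow> dual_value f X \<le> dual_cost f X w" using min val by simp
  let ?x = "response ws"
  have x: "?x \<in> consensus" using response_at_dual_minimizer[OF ws min] .
  then have feas: "?x \<in> feasible_set X" by (simp add: feasible_set_def response_mem)
  have cost: "total_cost f ?x = - dual_cost f X ws"
    using dual_cost_eq[of ws] consensus_inner_perp[OF x ws] by simp
  have opt: "total_cost f ?x \<le> total_cost f y" if "y \<in> feasible_set X" for y
    using dual_cost_ge_neg_total_cost[OF that ws] cost by simp
  have "primal_value f X = total_cost f ?x"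
    unfolding primal_value_def by (rule cInf_eq_minimum) (use feas opt in auto)
  then show prim: "primal_value f X = - dual_value f X" using cost val by simp
  have "is_arg_min (total_cost f) (\<lambda>y. y \<in> feasible_set X) (primal_solution f X)"
    unfolding primal_solution_def arg_min_on_def arg_min_def
    by (rule someI[of _ ?x]) (use feas opt in \<open>auto simp: is_arg_min_linorder\<close>)
  then have sol: "primal_solution f X \<in> feasible_set X"
    and sol_min: "total_cost f (primal_solution f X) \<le> total_cost f ?x"
    using feas unfolding is_arg_min_linorder by blast+
  show "primal_solution f X \<in> feasible_set X" by (rule sol)
  show "total_cost f (primal_solution f X) = primal_value f X"
    using opt[OF sol] sol_min prim cost val by linarith
qed

text \<open>
  Quadratic growth with the primal solution as competitor; its inner product with \<open>w\<close> vanishes.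
\<close>

lemma response_distance_le_dual_gap:
  assumes w: "w \<in> consensus_perp" and L: "L = 1 / (MIN i\<in>UNIV. \<theta> i)"
  shows "(norm (response w - primal_solution f X))\<^sup>2 \<le> 2 * L * (dual_cost f X w - dual_value f X)"
proof -
  let ?x = "primal_solution f X" and ?m = "MIN i\<in>UNIV. \<theta> i"
  have m: "?m > 0" using theta_pos by (subst Min_gr_iff) auto
  have "?m / 2 * (norm (?x - response w))\<^sup>2 = (\<Sum>i\<in>UNIV. ?m / 2 * (norm (?x $ i - response w $ i))\<^sup>2)"
    unfolding power2_norm_eq_inner inner_vec_def[of "?x - response w"] by (simp add: sum_distrib_left)
  also have "\<dots> \<le> (\<Sum>i\<in>UNIV. \<theta> i / 2 * (norm (?x $ i - response w $ i))\<^sup>2)"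
    by (intro sum_mono mult_right_mono divide_right_mono Min_le) auto
  also have "\<dots> \<le> dual_cost f X w - (w \<bullet> ?x - total_cost f ?x)"
    using dual_quadratic_growth[of ?x w] primal_solution_feasible by (force simp: feasible_set_def)
  also have "\<dots> = dual_cost f X w - dual_value f X"
    using consensus_inner_perp[OF _ w, of ?x] primal_solution_feasible total_cost_primal_solution
    by (simp add: feasible_set_def primal_value_eq)
  finally show ?thesis using m by (simp add: L norm_minus_commute field_simps)
qed

end

section \<open>Disagreement over a period of the network\<close>

lemma norm_add3_squared_le:
  fixes a b c :: "'a::real_inner"
  shows "(norm (a + b + c))\<^sup>2 \<le> 3 * ((norm a)\<^sup>2 + (norm b)\<^sup>2 + (norm c)\<^sup>2)"
proof -
  have "0 \<le> (norm (a - b))\<^sup>2 + (norm (b - c))\<^sup>2 + (norm (a - c))\<^sup>2" by simp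
  then show ?thesis
    unfolding power2_norm_eq_inner by (simp add: inner_diff inner_add inner_commute algebra_simps)
qed

lemma displacement_squared_le:
  fixes y :: "nat \<Rightarrow> 'a::real_normed_vector"
  assumes s: "s \<in> {k..<k + B}"
  shows "(norm (y s - y k))\<^sup>2 \<le> real B * (\<Sum>r\<in>{k..<k + B}. (norm (y (Suc r) - y r))\<^sup>2)"
proof -
  have "(norm (y s - y k))\<^sup>2 = (norm (\<Sum>r\<in>{k..<s}. y (Suc r) - y r))\<^sup>2"
    using s by (simp add: sum_Suc_diff')
  also have "\<dots> \<le> (\<Sum>r\<in>{k..<s}. norm (y (Suc r) - y r))\<^sup>2"
    by (intro power_mono norm_sum) simp
  also have "\<dots> \<le> (\<Sum>r\<in>{k..<k + B}. norm (y (Suc r) - y r))\<^sup>2"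
    using s by (intro power_mono sum_mono2 sum_nonneg) auto
  also have "\<dots> \<le> real B * (\<Sum>r\<in>{k..<k + B}. (norm (y (Suc r) - y r))\<^sup>2)"
    using sum_squared_le_sum_of_squares[of "\<lambda>r. norm (y (Suc r) - y r)" "{k..<k + B}"]
    by (simp add: mult.commute)
  finally show ?thesis .
qed

text \<open>
  An edge of \<open>Et\<close> is active at some time \<open>s\<close> of the period. Its difference at the initial time \<open>k\<close>
  is the difference at time \<open>s\<close> plus the displacements of its two end points between \<open>k\<close> and \<open>s\<close>.
  The factor 3 comes from squaring a sum of three vectors, \<open>B\<close> from squaring a displacement made of
  at most \<open>B\<close> steps, and \<open>D\<close> from the number of edges that share an end point.
\<close>

lemma edge_form_le_period_sum:
  fixes x :: "nat \<Rightarrow> 'n::finite \<Rightarrow> 'a::real_inner"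
  assumes Et: "Et \<subseteq> (\<Union>s\<in>{k..<k + B}. E s)"
    and deg: "\<And>i. real (card (neighbours Et i)) \<le> D"
    and h_lo: "h_lo > 0" and h: "\<And>s i j. {i, j} \<in> E s \<Longrightarrow> h_lo \<le> h s i j"
    and drift: "\<And>s. (\<Sum>i\<in>UNIV. (norm (x (Suc s) i - x s i))\<^sup>2) \<le> \<kappa> * edge_form (E s) (h s) (x s)"
  shows "edge_form Et (\<lambda>i j. 1) (x k)
    \<le> (3 * real B * D * \<kappa> + 3 / h_lo) * (\<Sum>s\<in>{k..<k + B}. edge_form (E s) (h s) (x s))"
proof -
  let ?T = "{k..<k + B}"
  define Q where "Q = (\<Sum>s\<in>?T. edge_form (E s) (h s) (x s))"
  \<comment> \<open>d bounds the squared displacement of a node; c is the share of an edge in the form at time s.\<close>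
  define d where "d i = real B * (\<Sum>r\<in>?T. (norm (x (Suc r) i - x r i))\<^sup>2)" for i
  define c where "c i j s = (if {i, j} \<in> E s then h s i j * (norm (x s i - x s j))\<^sup>2 else 0)" for i j s
  have c_nonneg: "0 \<le> c i j s" for i j s
    using h_lo h[of i j s] by (auto simp: c_def)
  have d_nonneg: "0 \<le> d i" for i by (auto simp: d_def intro!: sum_nonneg mult_nonneg_nonneg)
  have edge: "(norm (x k i - x k j))\<^sup>2 \<le> 3 * (d i + d j) + 3 / h_lo * (\<Sum>s\<in>?T. c i j s)"
    if ij: "j \<in> neighbours Et i" for i j
  proof -
    obtain s where s: "s \<in> ?T" "{i, j} \<in> E s" using ij Et by (auto simp: neighbours_iff)
    have "x k i - x k j = - (x s i - x k i) + (x s i - x s j) + (x s j - x k j)" by simp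
    then have "(norm (x k i - x k j))\<^sup>2
        \<le> 3 * ((norm (x s i - x k i))\<^sup>2 + (norm (x s i - x s j))\<^sup>2 + (norm (x s j - x k j))\<^sup>2)"
      by (metis norm_add3_squared_le norm_minus_cancel)
    moreover have "(norm (x s i - x k i))\<^sup>2 \<le> d i" "(norm (x s j - x k j))\<^sup>2 \<le> d j"
      unfolding d_def using displacement_squared_le[OF s(1), of "\<lambda>s. x s i"]
        displacement_squared_le[OF s(1), of "\<lambda>s. x s j"] by auto
    moreover have "(norm (x s i - x s j))\<^sup>2 \<le> 1 / h_lo * (\<Sum>s\<in>?T. c i j s)"
    proof -
      have "h_lo * (norm (x s i - x s j))\<^sup>2 \<le> c i j s"
        using h[OF s(2)] s(2) by (simp add: c_def mult_right_mono)
      also have "\<dots> \<le> (\<Sum>s\<in>?T. c i j s)"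
        using s(1) c_nonneg by (intro member_le_sum) auto
      finally show ?thesis using h_lo by (simp add: field_simps)
    qed
    ultimately show ?thesis by argo
  qed
  have "edge_form Et (\<lambda>i j. 1) (x k) = (\<Sum>i\<in>UNIV. \<Sum>j\<in>neighbours Et i. (norm (x k i - x k j))\<^sup>2) / 2"
    by (simp add: edge_form_def)
  also have "\<dots> \<le> (\<Sum>i\<in>UNIV. \<Sum>j\<in>neighbours Et i. 3 * (d i + d j) + 3 / h_lo * (\<Sum>s\<in>?T. c i j s)) / 2"
    by (intro divide_right_mono sum_mono edge) auto
  also have "\<dots> = 3 * ((\<Sum>i\<in>UNIV. \<Sum>j\<in>neighbours Et i. d i) + (\<Sum>i\<in>UNIV. \<Sum>j\<in>neighbours Et i. d j)) / 2
      + 3 / h_lo * ((\<Sum>i\<in>UNIV. \<Sum>j\<in>neighbours Et i. \<Sum>s\<in>?T. c i j s) / 2)"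
    by (simp only: sum.distrib sum_distrib_left[symmetric] add_divide_distrib distrib_left)
  also have "(\<Sum>i\<in>UNIV. \<Sum>j\<in>neighbours Et i. d j) = (\<Sum>i\<in>UNIV. \<Sum>j\<in>neighbours Et i. d i)"
    by (rule neighbours_sum_swap)
  also have "3 * ((\<Sum>i\<in>UNIV. \<Sum>j\<in>neighbours Et i. d i) + (\<Sum>i\<in>UNIV. \<Sum>j\<in>neighbours Et i. d i)) / 2
      = 3 * (\<Sum>i\<in>UNIV. real (card (neighbours Et i)) * d i)"
    by simp
  finally have split: "edge_form Et (\<lambda>i j. 1) (x k) \<le> 3 * (\<Sum>i\<in>UNIV. real (card (neighbours Et i)) * d i)
      + 3 / h_lo * ((\<Sum>i\<in>UNIV. \<Sum>j\<in>neighbours Et i. \<Sum>s\<in>?T. c i j s) / 2)" .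
  have D0: "D \<ge> 0" using deg[of undefined] by linarith
  have "(\<Sum>i\<in>UNIV. real (card (neighbours Et i)) * d i) \<le> (\<Sum>i\<in>UNIV. D * d i)"
    by (intro sum_mono mult_right_mono deg d_nonneg)
  also have "\<dots> = real B * D * (\<Sum>s\<in>?T. \<Sum>i\<in>UNIV. (norm (x (Suc s) i - x s i))\<^sup>2)"
    unfolding d_def by (subst sum.swap) (simp add: sum_distrib_left mult_ac)
  also have "\<dots> \<le> real B * D * (\<Sum>s\<in>?T. \<kappa> * edge_form (E s) (h s) (x s))"
    using D0 by (intro mult_left_mono sum_mono drift) auto
  also have "\<dots> = real B * D * \<kappa> * Q" by (simp add: Q_def sum_distrib_left mult_ac)
  finally have drift_part: "(\<Sum>i\<in>UNIV. real (card (neighbours Et i)) * d i) \<le> real B * D * \<kappa> * Q" .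
  have "(\<Sum>i\<in>UNIV. \<Sum>j\<in>neighbours Et i. \<Sum>s\<in>?T. c i j s) \<le> (\<Sum>i\<in>UNIV. \<Sum>j\<in>UNIV. \<Sum>s\<in>?T. c i j s)"
    by (intro sum_mono sum_mono2) (auto intro: sum_nonneg c_nonneg)
  also have "\<dots> = (\<Sum>i\<in>UNIV. \<Sum>s\<in>?T. \<Sum>j\<in>UNIV. c i j s)"
    by (intro sum.cong refl sum.swap)
  also have "\<dots> = (\<Sum>s\<in>?T. \<Sum>i\<in>UNIV. \<Sum>j\<in>UNIV. c i j s)"
    by (rule sum.swap)
  also have "\<dots> = 2 * Q"
    unfolding Q_def edge_form_def c_def neighbours_def
    by (simp add: sum.If_cases flip: sum_divide_distrib)
  finally have "(\<Sum>i\<in>UNIV. \<Sum>j\<in>neighbours Et i. \<Sum>s\<in>?T. c i j s) / 2 \<le> Q" by simp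
  then have "3 / h_lo * ((\<Sum>i\<in>UNIV. \<Sum>j\<in>neighbours Et i. \<Sum>s\<in>?T. c i j s) / 2) \<le> 3 / h_lo * Q"
    using h_lo by (intro mult_left_mono) auto
  then show ?thesis using split drift_part unfolding Q_def[symmetric] by (simp add: algebra_simps)
qed


section \<open>Decay of the dual gap\<close>

text \<open>
  The constant \<open>\<rho>\<close> bounds the decrease factor for every admissible step size: a concave function on
  an interval is smallest at an end point.
\<close>

lemma concave_quadratic_ge_min_endpoints:
  fixes lo hi a \<delta> :: real
  assumes "a \<in> {lo..hi}" "0 \<le> \<delta>"
  shows "min (lo - lo\<^sup>2 * \<delta> / 2) (hi - hi\<^sup>2 * \<delta> / 2) \<le> a - a\<^sup>2 * \<delta> / 2"
proof (cases "(a + lo) * \<delta> / 2 \<le> 1")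
  case True
  then have "0 \<le> (a - lo) * (1 - (a + lo) * \<delta> / 2)" using assms by simp
  also have "\<dots> = (a - a\<^sup>2 * \<delta> / 2) - (lo - lo\<^sup>2 * \<delta> / 2)"
    by (simp add: power2_eq_square field_simps)
  finally show ?thesis by simp
next
  case False
  moreover have "(a + lo) * \<delta> \<le> (a + hi) * \<delta>" using assms by (intro mult_right_mono) auto
  ultimately have "0 \<le> (hi - a) * ((a + hi) * \<delta> / 2 - 1)" using assms by simp
  also have "\<dots> = (a - a\<^sup>2 * \<delta> / 2) - (hi - hi\<^sup>2 * \<delta> / 2)"
    by (simp add: power2_eq_square field_simps)
  finally show ?thesis by simp
qed

text \<open>
  For positive values the recursion says that \<open>1 / e\<close> grows by at least \<open>b / a\<close> in every step. The
  induction uses the product form of this, so that vanishing values need no division.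
\<close>

lemma quadratic_recursion_bound:
  fixes e :: "nat \<Rightarrow> real"
  assumes a: "0 < a" and b: "0 \<le> b" and nonneg: "\<And>t. 0 \<le> e t"
    and step: "\<And>t. t < j \<Longrightarrow> b * (e t)\<^sup>2 \<le> a * (e t - e (Suc t))"
  shows "e j \<le> a * e 0 / (a + b * e 0 * real j)"
proof -
  have "b * e 0 * real t * e t \<le> a * (e 0 - e t)" if "t \<le> j" for t
    using that
  proof (induction t)
    case (Suc t)
    have st: "b * (e t)\<^sup>2 \<le> a * (e t - e (Suc t))" using step Suc.prems by simp
    have "0 \<le> a * (e t - e (Suc t))" using st b by (meson order_trans mult_nonneg_nonneg zero_le_power2)
    then have dec: "e (Suc t) \<le> e t" using a by (simp add: zero_le_mult_iff)
    show ?case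
    proof (cases "e (Suc t) = 0")
      case True
      then show ?thesis using a nonneg[of 0] by simp
    next
      case False
      then have pos: "0 < e t" using dec nonneg[of "Suc t"] by linarith
      \<comment> \<open>After multiplication by e t, the claim for Suc t is the sum of facts 1 and 2.\<close>
      have "b * (e t * e (Suc t)) \<le> b * (e t)\<^sup>2"
        using b dec nonneg[of t] by (simp add: power2_eq_square mult_left_mono)
      then have 1: "e 0 * (b * (e t * e (Suc t))) \<le> e 0 * (a * (e t - e (Suc t)))"
        using st nonneg[of 0] by (intro mult_left_mono) auto
      have 2: "e (Suc t) * (b * e 0 * real t * e t) \<le> e (Suc t) * (a * (e 0 - e t))"
        using Suc nonneg by (intro mult_left_mono) auto
      have "e t * (b * e 0 * real (Suc t) * e (Suc t)) \<le> e t * (a * (e 0 - e (Suc t)))"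
        using add_mono[OF 1 2] by (simp add: algebra_simps)
      then show ?thesis using pos by simp
    qed
  qed simp
  from this[of j] have "e j * (a + b * e 0 * real j) \<le> a * e 0" by (simp add: algebra_simps)
  moreover have "0 < a + b * e 0 * real j" using a b nonneg[of 0] by (simp add: add_pos_nonneg)
  ultimately show ?thesis by (simp add: pos_le_divide_eq)
qed

context consensus_problem
begin

text \<open>
  The first bound is the descent inequality: the linear term is \<open>- a\<close> times the disagreement, and the
  quadratic term is at most \<open>a\<^sup>2 \<delta> / 2\<close> times it. The second one bounds how far the responses move in
  one step by the same disagreement, which controls the drift over a period.
\<close>

lemma dual_gradient_step:
  assumes h: "\<And>i j. {i, j} \<in> E \<Longrightarrow> h i j = h j i" and h_nonneg: "\<And>i j. {i, j} \<in> E \<Longrightarrow> 0 \<le> h i j"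
    and \<delta>: "0 < \<delta>" and le: "\<And>u :: 'n \<Rightarrow> real^'d. edge_form E h u \<le> \<delta> * (\<Sum>i\<in>UNIV. \<theta> i * (norm (u i))\<^sup>2)"
    and v: "\<And>i. v $ i = w $ i - a *\<^sub>R edge_flow E h (\<lambda>i. response w $ i) i"
  shows "dual_cost f X v \<le> dual_cost f X w - (a - a\<^sup>2 * \<delta> / 2) * edge_form E h (\<lambda>i. response w $ i)"
    and "(\<Sum>i\<in>UNIV. (norm (response v $ i - response w $ i))\<^sup>2)
      \<le> a\<^sup>2 * \<delta> / (MIN i\<in>UNIV. \<theta> i) * edge_form E h (\<lambda>i. response w $ i)"
proof -
  let ?x = "\<lambda>i. response w $ i" and ?m = "MIN i\<in>UNIV. \<theta> i"
  let ?Q = "edge_form E h ?x" and ?g = "edge_flow E h ?x"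
  have flow: "(\<Sum>i\<in>UNIV. (norm (?g i))\<^sup>2 / \<theta> i) \<le> \<delta> * ?Q"
    by (rule edge_flow_weighted_norm_le[OF h h_nonneg theta_pos \<delta> le])
  have diff: "v $ i - w $ i = - (a *\<^sub>R ?g i)" for i by (simp add: v)
  have "response w \<bullet> (v - w) = - a * (\<Sum>i\<in>UNIV. ?x i \<bullet> ?g i)"
    unfolding inner_vec_def[of "response w"] by (simp add: diff sum_distrib_left sum_negf)
  also have "\<dots> = - a * ?Q" by (simp only: edge_flow_inner_self[OF h])
  finally have lin: "response w \<bullet> (v - w) = - a * ?Q" .
  have "(\<Sum>i\<in>UNIV. (norm (v $ i - w $ i))\<^sup>2 / (2 * \<theta> i)) = a\<^sup>2 / 2 * (\<Sum>i\<in>UNIV. (norm (?g i))\<^sup>2 / \<theta> i)"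
    by (simp add: diff power_mult_distrib sum_distrib_left)
  also have "\<dots> \<le> a\<^sup>2 / 2 * (\<delta> * ?Q)" by (rule mult_left_mono[OF flow]) simp
  finally show "dual_cost f X v \<le> dual_cost f X w - (a - a\<^sup>2 * \<delta> / 2) * ?Q"
    using dual_descent[of v w] lin by (simp add: algebra_simps)
  have m: "0 < ?m" using theta_pos by (subst Min_gr_iff) auto
  have "(norm (response v $ i - ?x i))\<^sup>2 \<le> a\<^sup>2 / ?m * ((norm (?g i))\<^sup>2 / \<theta> i)" for i
  proof -
    have "(norm (response v $ i - ?x i))\<^sup>2 \<le> (norm (v $ i - w $ i) / \<theta> i)\<^sup>2"
      by (intro power_mono response_lipschitz) simp
    also have "\<dots> = a\<^sup>2 * (norm (?g i))\<^sup>2 / \<theta> i * (1 / \<theta> i)"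
      by (simp add: diff power_mult_distrib power_divide power2_eq_square)
    also have "\<dots> \<le> a\<^sup>2 * (norm (?g i))\<^sup>2 / \<theta> i * (1 / ?m)"
      using m theta_pos[of i] by (intro mult_left_mono divide_left_mono Min_le) (auto simp: less_imp_le)
    finally show ?thesis by (simp add: mult.commute)
  qed
  then have "(\<Sum>i\<in>UNIV. (norm (response v $ i - ?x i))\<^sup>2)
      \<le> (\<Sum>i\<in>UNIV. a\<^sup>2 / ?m * ((norm (?g i))\<^sup>2 / \<theta> i))"
    by (rule sum_mono)
  also have "\<dots> = a\<^sup>2 / ?m * (\<Sum>i\<in>UNIV. (norm (?g i))\<^sup>2 / \<theta> i)" by (simp only: sum_distrib_left)
  also have "\<dots> \<le> a\<^sup>2 / ?m * (\<delta> * ?Q)" 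
    by (intro mult_left_mono flow divide_nonneg_nonneg zero_le_power2 less_imp_le[OF m])
  finally show "(\<Sum>i\<in>UNIV. (norm (response v $ i - ?x i))\<^sup>2) \<le> a\<^sup>2 * \<delta> / ?m * ?Q" by simp
qed

text \<open>
  Convexity bounds the gap by the inner product of the gradient with \<open>w - ws\<close>. That difference lies
  in \<open>consensus_perp\<close>, so only the projection of the gradient onto this space contributes.
\<close>

lemma dual_gap_le_deviation:
  assumes w: "w \<in> consensus_perp"
  shows "dual_cost f X w - dual_value f X
    \<le> norm (mean_deviation (response w)) * (INF ws\<in>dual_solutions f X. norm (w - ws))"
proof -
  let ?d = "norm (mean_deviation (response w))"
  have le: "dual_cost f X w - dual_value f X \<le> ?d * norm (w - ws)" if ws: "ws \<in> dual_solutions f X" for ws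
  proof -
    have "w - ws \<in> consensus_perp"
      using w ws by (auto simp: dual_solutions_def intro: subspace_diff)
    then have "response w \<bullet> (w - ws) \<le> ?d * norm (w - ws)"
      using inner_mean_deviation[of "w - ws" "response w"] norm_cauchy_schwarz[of "mean_deviation (response w)" "w - ws"]
      by simp
    then show ?thesis
      using dual_above_tangent[of w ws] ws by (simp add: dual_solutions_def inner_diff_right)
  qed
  show ?thesis
  proof (cases "?d = 0")
    case True
    then show ?thesis using le dual_solutions_nonempty by fastforce
  next
    case False
    then have d: "0 < ?d" by simp
    have "(dual_cost f X w - dual_value f X) / ?d \<le> (INF ws\<in>dual_solutions f X. norm (w - ws))"
      by (rule cINF_greatest[OF dual_solutions_nonempty]) (use le d in \<open>simp add: divide_le_eq mult.commute\<close>)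
    then show ?thesis using d by (simp add: divide_le_eq mult.commute)
  qed
qed

end

section \<open>Convergence rate of the Fenchel dual gradient method\<close>

theorem theorem3:
  fixes f :: "'n::finite \<Rightarrow> real^'d \<Rightarrow> real"
    and X :: "'n \<Rightarrow> (real^'d) set"
    and \<theta> :: "'n \<Rightarrow> real"
    and E Et :: "nat \<Rightarrow> 'n set set"
    and h :: "nat \<Rightarrow> 'n \<Rightarrow> 'n \<Rightarrow> real"
    and \<alpha> :: "nat \<Rightarrow> real"
    and w x :: "nat \<Rightarrow> real^'d^'n"
    and B :: nat
    and h_lo h_hi \<alpha>_lo \<alpha>_hi \<delta> M0 L \<eta> \<rho> lam deg_bar :: real
    and M R :: "nat \<Rightarrow> real"
  assumes n_ge_2: "CARD('n) \<ge> 2"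
    and f_convex: "\<And>i. convex_on UNIV (f i)"
    and X_closed: "\<And>i. closed (X i)"
    and X_convex: "\<And>i. convex (X i)"
    and \<theta>_pos: "\<And>i. \<theta> i > 0"
    and f_strong: "\<And>i. strongly_convex_over (f i) (X i) (\<theta> i)"
    and zero_interior: "0 \<in> interior (\<Inter>i. X i)"
    and E_simple: "\<And>k. simple_edges (E k)"
    and E_nonempty: "\<And>k. E k \<noteq> {}"
    and h_sym: "\<And>k i j. {i, j} \<in> E k \<Longrightarrow> h k i j = h k j i"
    and h_range: "\<And>k i j. {i, j} \<in> E k \<Longrightarrow> h k i j \<in> {h_lo..h_hi}"
    and h_interval: "{h_lo..h_hi} \<subseteq> {0<..}"
    and B_pos: "B > 0"
    and B_connected: "\<And>k. graph_connected (\<Union>t\<in>{k * B..<(k + 1) * B}. E t)"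
    and iterates: "fenchel_dual_gradient f X E h \<alpha> w x"
    and \<delta>_pos: "\<delta> > 0"
    and \<delta>_bound: "\<And>k. weight_matrix (E k) (h k) \<preceq> \<delta> *\<^sub>R matrix_inv (diag_matrix (\<lambda>i. 1 / \<theta> i))"
    and \<alpha>_range: "\<And>k. \<alpha> k \<in> {\<alpha>_lo..\<alpha>_hi}"
    and \<alpha>_interval: "{\<alpha>_lo..\<alpha>_hi} \<subseteq> {0<..<2 / \<delta>}"
    and Et_subgraph: "\<And>t. Et (t * B) \<subseteq> (\<Union>s\<in>{t * B..<t * B + B}. E s)"
    and Et_connected: "\<And>t. graph_connected (Et (t * B))"
    and M0_pos: "M0 > 0"
    and L_eq: "L = 1 / (MIN i\<in>UNIV. \<theta> i)"
    and deg_bar_eq: "deg_bar = real (SUP t. max_degree (Et (t * B)))"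
    and lam_eq: "lam = (INF t. nth_largest_eigenvalue (CARD('n) - 1) (laplacian (Et (t * B))))"
    and \<eta>_eq: "\<eta> = 3 * real B * deg_bar * \<alpha>_hi\<^sup>2 * \<delta> * L + 3 / h_lo"
    and \<rho>_eq: "\<rho> = min (\<alpha>_lo - \<alpha>_lo\<^sup>2 * \<delta> / 2) (\<alpha>_hi - \<alpha>_hi\<^sup>2 * \<delta> / 2)"
    and M_eq: "\<And>j. M j = max_dual_distance f X B M0 w j"
    and R_eq: "\<And>k. R k = sqrt (2 * L * \<eta> * (M (k div B))\<^sup>2 * (dual_cost f X (w 0) - dual_value f X)
                     / (\<eta> * (M (k div B))\<^sup>2
                        + \<rho> * lam * (dual_cost f X (w 0) - dual_value f X) * real (k div B)))"
  shows "\<forall>k. norm (closest_point consensus_perp (x k)) \<le> norm (x k - primal_solution f X)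
           \<and> norm (x k - primal_solution f X) \<le> R k
           \<and> total_cost f (x k) - primal_value f X \<le> norm (w k) * R k
           \<and> (\<forall>ws. is_arg_max (\<lambda>v. - dual_cost f X v) (\<lambda>v. v \<in> consensus_perp) ws \<longrightarrow>
                 total_cost f (x k) - primal_value f X \<ge> - norm ws * R k)"
proof -
  obtain e where e: "e \<in> E 0" using E_nonempty by blast
  then have "card e = 2" using E_simple[of 0] by (simp add: simple_edges_def)
  then obtain i j where "e = {i, j}" by (meson card_2_iff)
  with e have ij: "{i, j} \<in> E 0" by simp
  have h_lo: "h_lo > 0" using h_range[OF ij] h_interval by force
  have h_nonneg: "0 \<le> h k i j" if "{i, j} \<in> E k" for k i j
    using h_range[OF that] h_lo by simp
  have \<alpha>_bounds: "0 < \<alpha>_lo" "\<alpha>_lo \<le> \<alpha>_hi" "\<alpha>_hi < 2 / \<delta>"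
  proof -
    show le: "\<alpha>_lo \<le> \<alpha>_hi" using \<alpha>_range[of 0] by simp
    then have "\<alpha>_lo \<in> {0<..<2 / \<delta>}" "\<alpha>_hi \<in> {0<..<2 / \<delta>}"
      using \<alpha>_interval by (simp_all add: subset_iff)
    then show "0 < \<alpha>_lo" "\<alpha>_hi < 2 / \<delta>" by simp_all
  qed
  have X_zero: "0 \<in> X i" for i using zero_interior interior_subset by blast
  interpret consensus_problem f X \<theta>
  proof (rule consensus_problem.intro)
    show "strongly_convex_objective (f i) (X i) (\<theta> i)" for i
      using f_convex X_closed X_convex X_zero[of i] \<theta>_pos f_strong by unfold_locales auto
    show "0 \<in> interior (\<Inter>i. X i)" by (rule zero_interior)
  qed
  let ?D = "dual_cost f X" and ?S = "consensus_perp :: (real^'d^'n) set" and ?xs = "primal_solution f X"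
  note algorithm = iterates[unfolded fenchel_dual_gradient_def]
  have x: "x k = response (w k)" for k
    unfolding vec_eq_iff response_def using algorithm[THEN conjunct2, THEN conjunct1] by simp
  have w_step: "w (Suc k) $ i = w k $ i - \<alpha> k *\<^sub>R edge_flow (E k) (h k) (\<lambda>i. x k $ i) i" for k i
    unfolding edge_flow_def by (rule algorithm[THEN conjunct2, THEN conjunct2, rule_format])
  have w_perp: "w k \<in> ?S" for k
  proof (induction k)
    case 0
    show ?case by (rule algorithm[THEN conjunct1])
  next
    case (Suc k)
    have "(\<Sum>i\<in>UNIV. edge_flow (E k) (h k) (\<lambda>i. x k $ i) i) = 0"
      by (rule edge_flow_sum_zero[OF h_sym])
    then have "(\<Sum>i\<in>UNIV. w (Suc k) $ i) = (\<Sum>i\<in>UNIV. w k $ i)"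
      unfolding w_step sum_subtractf by (simp flip: scaleR_right.sum)
    then show ?case using Suc by (simp add: consensus_perp_def)
  qed
  define Q where "Q k = edge_form (E k) (h k) (\<lambda>i. x k $ i)" for k
  have Q_nonneg: "0 \<le> Q k" for k unfolding Q_def by (rule edge_form_nonneg) (rule h_nonneg)
  have form_le: "edge_form (E k) (h k) u \<le> \<delta> * (\<Sum>i\<in>UNIV. \<theta> i * (norm (u i))\<^sup>2)"
    for k and u :: "'n \<Rightarrow> real^'d"
    by (rule loewner_le_diag_edge_form[OF E_simple h_sym \<theta>_pos \<delta>_bound])
  define m where "m = (MIN i\<in>UNIV. \<theta> i)"
  have m: "0 < m" unfolding m_def using \<theta>_pos by (subst Min_gr_iff) auto
  have L: "L = 1 / m" "0 < L" using m by (auto simp: L_eq m_def)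

  have \<rho>_pos: "0 < \<rho>"
  proof -
    have "0 < a - a\<^sup>2 * \<delta> / 2" if "0 < a" "a < 2 / \<delta>" for a
    proof -
      have "a * \<delta> < 2" using that \<delta>_pos by (simp add: field_simps)
      then have "0 < a * (1 - a * \<delta> / 2)" using that by simp
      then show ?thesis by (simp add: power2_eq_square algebra_simps)
    qed
    then show ?thesis unfolding \<rho>_eq using \<alpha>_bounds by simp
  qed
  have descent: "?D (w (Suc k)) \<le> ?D (w k) - \<rho> * Q k" for k
  proof -
    have "\<rho> * Q k \<le> (\<alpha> k - (\<alpha> k)\<^sup>2 * \<delta> / 2) * Q k"
      unfolding \<rho>_eq using concave_quadratic_ge_min_endpoints[OF \<alpha>_range[of k], of \<delta>] \<delta>_pos Q_nonneg
      by (intro mult_right_mono) auto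
    moreover have "?D (w (Suc k)) \<le> ?D (w k) - (\<alpha> k - (\<alpha> k)\<^sup>2 * \<delta> / 2) * Q k"
      using dual_gradient_step(1)[OF h_sym h_nonneg \<delta>_pos form_le w_step[unfolded x]]
      unfolding Q_def x .
    ultimately show ?thesis by linarith
  qed
  have drift: "(\<Sum>i\<in>UNIV. (norm (x (Suc k) $ i - x k $ i))\<^sup>2) \<le> \<alpha>_hi\<^sup>2 * \<delta> * L * Q k" for k
  proof -
    have "(\<Sum>i\<in>UNIV. (norm (x (Suc k) $ i - x k $ i))\<^sup>2) \<le> (\<alpha> k)\<^sup>2 * \<delta> / m * Q k"
      using dual_gradient_step(2)[OF h_sym h_nonneg \<delta>_pos form_le w_step[unfolded x]]
      unfolding Q_def x m_def .
    also have "\<dots> \<le> \<alpha>_hi\<^sup>2 * \<delta> / m * Q k"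
      using \<alpha>_range[of k] \<alpha>_bounds \<delta>_pos m Q_nonneg
      by (intro mult_right_mono divide_right_mono power_mono) auto
    finally show ?thesis by (simp add: L)
  qed
  have decreasing: "?D (w (k + n)) \<le> ?D (w k) - \<rho> * (\<Sum>s\<in>{k..<k + n}. Q s)" for k n
  proof (induction n)
    case (Suc n)
    then show ?case using descent[of "k + n"] by (simp add: algebra_simps)
  qed simp
  have decreasing': "?D (w (k + n)) \<le> ?D (w k)" for k n
    using decreasing[of k n] \<rho>_pos Q_nonneg by (smt (verit) mult_nonneg_nonneg sum_nonneg)

  have deg: "real (card (neighbours (Et (t * B)) i)) \<le> deg_bar" for t i
  proof -
    have "card (neighbours (Et (t * B)) i) \<le> max_degree (Et (t * B))"
      unfolding max_degree_def by (rule Max_ge) auto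
    also have "\<dots> \<le> (SUP t. max_degree (Et (t * B)))"
    proof (rule cSUP_upper)
      have "finite (range (\<lambda>t. max_degree (Et (t * B))))"
        by (rule finite_subset[of _ "range (max_degree :: 'n set set \<Rightarrow> nat)"]) auto
      then show "bdd_above (range (\<lambda>t. max_degree (Et (t * B))))" by (rule bdd_above_finite)
    qed simp
    finally show ?thesis by (simp add: deg_bar_eq)
  qed
  have Et_simple: "simple_edges (Et (t * B))" for t
    using Et_subgraph[of t] E_simple unfolding simple_edges_def by blast
  let ?\<mu> = "\<lambda>t. nth_largest_eigenvalue (CARD('n) - 1) (laplacian (Et (t * B)))"
  have \<mu>_nonneg: "0 \<le> ?\<mu> t" for t by (rule laplacian_eigenvalue_nonneg[OF Et_simple n_ge_2])
  have lam_nonneg: "0 \<le> lam" unfolding lam_eq by (rule cINF_greatest) (use \<mu>_nonneg in auto)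
  have lam_le: "lam \<le> ?\<mu> t" for t
  proof -
    have "bdd_below (range ?\<mu>)" using \<mu>_nonneg by (intro bdd_belowI[of _ 0]) blast
    then show ?thesis unfolding lam_eq by (rule cINF_lower) simp
  qed
  have deg_nonneg: "0 \<le> deg_bar" by (simp add: deg_bar_eq)
  have \<eta>_pos: "0 < \<eta>"
    unfolding \<eta>_eq using deg_nonneg \<delta>_pos L(2) h_lo
    by (intro add_nonneg_pos mult_nonneg_nonneg divide_pos_pos) auto

  define gap where "gap k = ?D (w k) - dual_value f X" for k
  have gap_nonneg: "0 \<le> gap k" for k using dual_value_le[OF w_perp] by (simp add: gap_def)
  define dist_opt where "dist_opt t = (INF ws\<in>dual_solutions f X. norm (w (t * B) - ws))" for t
  have dist_opt_nonneg: "0 \<le> dist_opt t" for t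
    unfolding dist_opt_def by (rule cINF_greatest[OF dual_solutions_nonempty]) simp
  have period: "lam * (norm (mean_deviation (x (t * B))))\<^sup>2 \<le> \<eta> * (\<Sum>s\<in>{t * B..<t * B + B}. Q s)" for t
  proof -
    have "lam * (norm (mean_deviation (x (t * B))))\<^sup>2 \<le> ?\<mu> t * (norm (mean_deviation (x (t * B))))\<^sup>2"
      by (rule mult_right_mono[OF lam_le]) simp
    also have "\<dots> \<le> edge_form (Et (t * B)) (\<lambda>i j. 1) (\<lambda>i. x (t * B) $ i)"
      by (rule laplacian_eigenvalue_le_edge_form_deviation[OF Et_simple n_ge_2])
    also have "\<dots> \<le> (3 * real B * deg_bar * (\<alpha>_hi\<^sup>2 * \<delta> * L) + 3 / h_lo) * (\<Sum>s\<in>{t * B..<t * B + B}. Q s)"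
      unfolding Q_def
      by (rule edge_form_le_period_sum[where x = "\<lambda>k i. x k $ i", OF Et_subgraph deg h_lo])
        (use h_range drift in \<open>auto simp: Q_def\<close>)
    finally show ?thesis by (simp add: \<eta>_eq mult.assoc)
  qed
  \<comment> \<open>The recursion over one period; b stands for any bound on the distance to the dual solutions.\<close>
  have gap_step: "\<rho> * lam * (gap (t * B))\<^sup>2 \<le> \<eta> * b\<^sup>2 * (gap (t * B) - gap (Suc t * B))"
    if b: "dist_opt t \<le> b" for t b
  proof -
    let ?d = "norm (mean_deviation (x (t * B)))"
    have "gap (t * B) \<le> ?d * dist_opt t"
      unfolding gap_def dist_opt_def x by (rule dual_gap_le_deviation[OF w_perp])
    also have "\<dots> \<le> ?d * b" using b by (rule mult_left_mono) simp
    finally have "(gap (t * B))\<^sup>2 \<le> (?d * b)\<^sup>2" using gap_nonneg by (rule power_mono)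
    then have "\<rho> * lam * (gap (t * B))\<^sup>2 \<le> \<rho> * lam * (?d * b)\<^sup>2"
      using \<rho>_pos lam_nonneg by (intro mult_left_mono) auto
    also have "\<dots> = \<rho> * b\<^sup>2 * (lam * ?d\<^sup>2)" by (simp add: power_mult_distrib)
    also have "\<dots> \<le> \<rho> * b\<^sup>2 * (\<eta> * (\<Sum>s\<in>{t * B..<t * B + B}. Q s))"
      using \<rho>_pos by (intro mult_left_mono period) auto
    also have "\<dots> = \<eta> * b\<^sup>2 * (\<rho> * (\<Sum>s\<in>{t * B..<t * B + B}. Q s))" by simp
    also have "\<dots> \<le> \<eta> * b\<^sup>2 * (gap (t * B) - gap (Suc t * B))"
      using decreasing[of "t * B" B] \<eta>_pos
      by (intro mult_left_mono) (auto simp: gap_def add.commute)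
    finally show ?thesis .
  qed
  have M_ge: "dist_opt t \<le> M j" if "t < j" for t j
    using that unfolding M_eq max_dual_distance_def dist_opt_def by (auto intro!: Max_ge)
  have M_nonneg: "0 \<le> M j" for j
  proof (cases "j = 0")
    case True
    then show ?thesis using M0_pos by (simp add: M_eq max_dual_distance_def)
  next
    case False
    then show ?thesis using M_ge[of 0 j] dist_opt_nonneg[of 0] by simp
  qed
  \<comment> \<open>Every iterate is compared with the start of its period.\<close>
  have gap_bound: "gap k \<le> \<eta> * (M (k div B))\<^sup>2 * gap 0 / (\<eta> * (M (k div B))\<^sup>2 + \<rho> * lam * gap 0 * real (k div B))" for k
  proof -
    let ?j = "k div B"
    have "gap k \<le> gap (?j * B)"
      using decreasing'[of "?j * B" "k mod B"] by (simp add: gap_def)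
    also have "\<dots> \<le> \<eta> * (M ?j)\<^sup>2 * gap 0 / (\<eta> * (M ?j)\<^sup>2 + \<rho> * lam * gap 0 * real ?j)"
    proof (cases "M ?j = 0")
      case True
      moreover have "M 0 = M0" by (simp add: M_eq max_dual_distance_def)
      ultimately have "?j \<noteq> 0" using M0_pos by (metis less_irrefl)
      \<comment> \<open>The initial point is dual optimal, and the fraction is 0 / 0 = 0.\<close>
      then have "dist_opt 0 = 0" using M_ge[of 0 ?j] dist_opt_nonneg[of 0] True by simp
      then have "gap 0 \<le> 0"
        using dual_gap_le_deviation[OF w_perp[of 0]] by (simp add: gap_def dist_opt_def)
      moreover have "gap (?j * B) \<le> gap 0" using decreasing'[of 0 "?j * B"] by (simp add: gap_def)
      ultimately show ?thesis using True by simp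
    next
      case False
      then have "0 < \<eta> * (M ?j)\<^sup>2" using \<eta>_pos by simp
      moreover have "0 \<le> \<rho> * lam" using \<rho>_pos lam_nonneg by simp
      ultimately show ?thesis
        using quadratic_recursion_bound[of "\<eta> * (M ?j)\<^sup>2" "\<rho> * lam" "\<lambda>t. gap (t * B)" ?j]
          gap_nonneg gap_step[OF M_ge] by simp
    qed
    finally show ?thesis .
  qed
  have dist: "norm (x k - ?xs) \<le> R k" for k
  proof -
    have "(norm (x k - ?xs))\<^sup>2 \<le> 2 * L * gap k"
      unfolding x gap_def by (rule response_distance_le_dual_gap[OF w_perp L_eq])
    also have "\<dots> \<le> 2 * L * (\<eta> * (M (k div B))\<^sup>2 * gap 0 / (\<eta> * (M (k div B))\<^sup>2 + \<rho> * lam * gap 0 * real (k div B)))"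
      using L(2) by (intro mult_left_mono gap_bound) auto
    finally show ?thesis unfolding R_eq gap_def by (intro real_le_rsqrt) (simp add: mult.assoc)
  qed
  have xs: "?xs \<in> consensus" "?xs \<in> feasible_set X"
    using primal_solution_feasible by (auto simp: feasible_set_def)
  show ?thesis
  proof (intro allI conjI impI)
    fix k
    show "norm (closest_point ?S (x k)) \<le> norm (x k - ?xs)"
      by (rule norm_closest_point_consensus_perp_le[OF xs(1)])
    show "norm (x k - ?xs) \<le> R k" by (rule dist)
    have "total_cost f (x k) - primal_value f X \<le> w k \<bullet> (x k - ?xs)"
      using dual_cost_eq[of "w k"] dual_value_le[OF w_perp[of k]] consensus_inner_perp[OF xs(1) w_perp[of k]]
      by (simp add: x[of k] primal_value_eq inner_diff_right)
    also have "\<dots> \<le> norm (w k) * norm (x k - ?xs)" by (rule norm_cauchy_schwarz)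
    also have "\<dots> \<le> norm (w k) * R k" by (intro mult_left_mono dist) simp
    finally show "total_cost f (x k) - primal_value f X \<le> norm (w k) * R k" .
    fix ws :: "real^'d^'n"
    assume "is_arg_max (\<lambda>v. - ?D v) (\<lambda>v. v \<in> ?S) ws"
    then have ws: "ws \<in> ?S" "\<And>v. v \<in> ?S \<Longrightarrow> ?D ws \<le> ?D v"
      by (auto simp: is_arg_max_linorder)
    obtain v where "v \<in> dual_solutions f X" using dual_solutions_nonempty by blast
    then have "?D ws \<le> dual_value f X" using ws(2)[of v] by (simp add: dual_solutions_def)
    then have "ws \<bullet> (x k - ?xs) \<le> total_cost f (x k) - primal_value f X"
      using dual_weak_duality[of "x k" ws] consensus_inner_perp[OF xs(1) ws(1)]
      by (simp add: x response_mem primal_value_eq inner_diff_right)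
    moreover have "- (norm ws * norm (x k - ?xs)) \<le> ws \<bullet> (x k - ?xs)"
      using Cauchy_Schwarz_ineq2[of ws "x k - ?xs"] by linarith
    moreover have "norm ws * norm (x k - ?xs) \<le> norm ws * R k" by (intro mult_left_mono dist) simp
    ultimately show "- norm ws * R k \<le> total_cost f (x k) - primal_value f X" by simp
  qed
qed

end
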